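(* Fix an integer $d \ge 1$. For each integer $L \ge 1$ let $B_L = \{0, \dots, L\}^d$ be the box of side length $L$ in $\mathbf{Z}^d$, regarded as a graph, and let $m_L$ be any integer with $1 \le m_L \le (L+1)^d - 1$. Then the spectral gap for the symmetric exclusion process with $m_L$ particles in $B_L$ is asymptotic to $\pi^2/L^2$ as $L \to \infty$, that is, $L^2/\pi^2$ times this spectral gap converges to $1$.
   Context: The box $B_L = \{0,\dots,L\}^d$ is the graph with this vertex set in which two vertices are joined by an edge exactly when they are nearest neighbours in $\mathbf{Z}^d$ (they differ by $1$ in exactly one coordinate and agree in the others). Symmetric exclusion process. Let $G$ be a connected, undirected graph with $n$ vertices and let $1 \le m \le n-1$. The symmetric exclusion process with $m$ particles in $G$ is the continuous-time Markov chain whose states are the $m$-element subsets of the vertex set (the sets of sites occupied by $m$ indistinguishable particles), in which each particle jumps along each edge incident to its current vertex at rate $1$, with moves that take two particles to the same vertex suppressed. Equivalently, for each edge $\{i,j\}$ with exactly one occupied endpoint, at rate $1$ the particle at that endpoint moves to the other endpoint. Spectral gap. For a continuous-time Markov chain on a finite state space $W$ with symmetric transition rate matrix $Q$ (off-diagonal entries are the transition rates, rows sum to $0$), irreducible, the spectral gap is the minimum value of $\alpha>0$ such that $Qf = -\alpha f$ for some nonzero $f: W \to \mathbf{R}$. *)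

theory Defs
  imports Complex_Main "HOL-Library.FuncSet"
begin

text \<open>A graph is given by a vertex set \<^term>\<open>V :: 'a set\<close> and a set
  \<^term>\<open>E :: 'a set set\<close> of undirected edges. A point of \<open>\<int>\<^sup>d\<close> is a function on \<open>{..<d}\<close>,
  extended by \<^const>\<open>undefined\<close> so that distinct functions are distinct points.\<close>

definition box_verts :: "nat \<Rightarrow> nat \<Rightarrow> (nat \<Rightarrow> int) set" where
  "box_verts d L = ({..<d} \<rightarrow>\<^sub>E {0..int L})"

definition nearest_neighbours :: "nat \<Rightarrow> (nat \<Rightarrow> int) \<Rightarrow> (nat \<Rightarrow> int) \<Rightarrow> bool" where
  "nearest_neighbours d x y \<longleftrightarrow>
     (\<exists>k<d. \<bar>x k - y k\<bar> = 1 \<and> (\<forall>i<d. i \<noteq> k \<longrightarrow> x i = y i))"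

definition box_edges :: "nat \<Rightarrow> nat \<Rightarrow> (nat \<Rightarrow> int) set set" where
  "box_edges d L =
     {{x, y} | x y. x \<in> box_verts d L \<and> y \<in> box_verts d L \<and> nearest_neighbours d x y}"

text \<open>A continuous-time Markov chain on a finite set \<open>W\<close> is given by its transition rates
  \<open>q x y\<close> for \<open>x \<noteq> y\<close>; the diagonal of the rate matrix makes its rows sum to 0.\<close>

definition rate_matrix :: "'w set \<Rightarrow> ('w \<Rightarrow> 'w \<Rightarrow> real) \<Rightarrow> 'w \<Rightarrow> 'w \<Rightarrow> real" where
  "rate_matrix W q x y = (if x = y then - (\<Sum>z\<in>W - {x}. q x z) else q x y)"

text \<open>Functions \<open>W \<rightarrow> \<real>\<close> are total functions of which only the values on \<open>W\<close> matter.
  \<open>LEAST\<close> over the reals is the minimum whenever that minimum exists, which is the case for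
  a symmetric irreducible \<open>Q\<close> on a finite \<open>W\<close> with at least two elements.\<close>

definition spectral_gap :: "'w set \<Rightarrow> ('w \<Rightarrow> 'w \<Rightarrow> real) \<Rightarrow> real" where
  "spectral_gap W Q =
     (LEAST \<alpha>. \<alpha> > 0 \<and>
        (\<exists>f :: 'w \<Rightarrow> real. (\<exists>x\<in>W. f x \<noteq> 0) \<and>
           (\<forall>x\<in>W. (\<Sum>y\<in>W. Q x y * f y) = - \<alpha> * f x)))"

definition exclusion_states :: "'a set \<Rightarrow> nat \<Rightarrow> 'a set set" where
  "exclusion_states V m = {A. A \<subseteq> V \<and> card A = m}"

text \<open>Each edge with exactly one occupied endpoint contributes rate 1 to the transition that
  moves the particle along it.\<close>

definition exclusion_rate :: "'a set set \<Rightarrow> 'a set \<Rightarrow> 'a set \<Rightarrow> real" where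
  "exclusion_rate E A B =
     real (card {e \<in> E. \<exists>i j. e = {i, j} \<and> i \<in> A \<and> j \<notin> A \<and> B = insert j (A - {i})})"

definition exclusion_gap :: "'a set \<Rightarrow> 'a set set \<Rightarrow> nat \<Rightarrow> real" where
  "exclusion_gap V E m =
     spectral_gap (exclusion_states V m)
       (rate_matrix (exclusion_states V m) (exclusion_rate E))"

end

theory Submission
  imports Defs "HOL-Combinatorics.Transposition"
begin

text \<open>For every \<open>m\<close> strictly between \<open>0\<close> and the number of sites, the gap in the box
equals the gap \<open>2 - 2 cos (\<pi> / (L + 1))\<close> of a single random walker, and this number is
asymptotic to \<open>\<pi>\<^sup>2 / L\<^sup>2\<close>.

The upper bound is explicit: the sum over the occupied sites of a cosine of one coordinate is an
eigenfunction (\<open>exclusion_generator_site_sum\<close>, \<open>box_cos_mode_eigen\<close>). The lower bound is the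
statement that passing from one particle to \<open>m\<close> particles does not decrease the gap, on any finite
weighted graph (\<open>exclusion_poincare\<close>). This is the exclusion case of Aldous' conjecture, and it is
proved along the lines of Caputo, Liggett and Richthammer, by induction on the number of vertices.
Split a function of the configuration into a part linear in the occupation numbers and a part
whose sum over the configurations occupying \<open>x\<close> vanishes for each site \<open>x\<close>. The two parts are
orthogonal also for the Dirichlet form. The linear part is governed by the random walk. For the
other part, delete a vertex \<open>r\<close> and give the remaining vertices the weights of the electrically
reduced network; conditioning on the occupation of \<open>r\<close> leaves two exclusion processes on the
smaller graph, to which induction applies. The reduction does not decrease the gap of the random
walk (harmonic extension, \<open>rw_poincare_reduced\<close>), and it does not increase the Dirichlet form of
exclusion: this is the octopus inequality (\<open>octopus\<close>).

The octopus inequality has a short proof when there are only two kinds of sites, occupied and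
vacant. Write \<open>P\<^sub>x\<^sub>y f = f - f \<circ> swap\<^sub>x\<^sub>y\<close> and let \<open>e\<^sub>x\<^sub>y\<close> be half of the squared norm of
\<open>P\<^sub>x\<^sub>y f\<close>. Three sites always contain two of the same kind, which makes the inner product of
\<open>P\<^sub>x\<^sub>y f\<close> and \<open>P\<^sub>x\<^sub>z f\<close> equal to \<open>(e\<^sub>x\<^sub>y + e\<^sub>x\<^sub>z - e\<^sub>y\<^sub>z) / 2\<close> (\<open>three_point_identity\<close>). Let the
weights \<open>b\<close> have total \<open>0\<close> with only \<open>b\<^sub>r\<close> negative, and expand the nonnegative number
\<open>\<parallel>\<Sum>\<^sub>x\<^sub>y b\<^sub>x b\<^sub>y P\<^sub>x\<^sub>y f\<parallel>\<^sup>2\<close>. The pairs of swaps that share a site contribute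
\<open>- 2 (\<Sum> b\<^sub>x\<^sup>2) (\<Sum> b\<^sub>x b\<^sub>y e\<^sub>x\<^sub>y)\<close>, and the disjoint pairs contribute at most \<open>0\<close>, by a five-point
inequality that again comes from the three-point geometry. Hence \<open>\<Sum> b\<^sub>x b\<^sub>y e\<^sub>x\<^sub>y \<le> 0\<close>, which is
the octopus inequality.\<close>

section \<open>Exchanging the contents of two sites\<close>
definition swap_sites :: "'a \<Rightarrow> 'a \<Rightarrow> 'a set \<Rightarrow> 'a set" where
  "swap_sites x y A = transpose x y ` A"

lemma swap_sites_alt:
  "swap_sites x y A = (if x \<in> A \<and> y \<notin> A then insert y (A - {x})
     else if y \<in> A \<and> x \<notin> A then insert x (A - {y}) else A)"
  by (auto simp: swap_sites_def transpose_def image_iff)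

lemma swap_sites_swap_sites [simp]: "swap_sites x y (swap_sites x y A) = A"
  by (simp add: swap_sites_def image_image)

lemma swap_sites_same [simp]: "swap_sites x x A = A"
  by (simp add: swap_sites_alt)

lemma swap_sites_sym: "swap_sites x y A = swap_sites y x A"
  by (simp add: swap_sites_alt)

lemma swap_sites_comm:
  "{x, y} \<inter> {z, w} = {} \<Longrightarrow> swap_sites x y (swap_sites z w A) = swap_sites z w (swap_sites x y A)"
  by (auto simp: swap_sites_def image_image transpose_def intro!: image_cong)

lemma card_swap_sites [simp]: "card (swap_sites x y A) = card A"
  by (simp add: swap_sites_def card_image)

lemma swap_sites_subset: "x \<in> V \<Longrightarrow> y \<in> V \<Longrightarrow> A \<subseteq> V \<Longrightarrow> swap_sites x y A \<subseteq> V"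
  by (auto simp: swap_sites_alt split: if_splits)

lemma sum_swap_sites:
  assumes "\<And>A. A \<in> S \<Longrightarrow> swap_sites x y A \<in> S"
  shows "(\<Sum>A\<in>S. F (swap_sites x y A)) = (\<Sum>A\<in>S. F A)"
  by (rule sum.reindex_bij_witness[of _ "swap_sites x y" "swap_sites x y"]) (auto intro: assms)

definition swap_grad :: "('a set \<Rightarrow> real) \<Rightarrow> 'a \<Rightarrow> 'a \<Rightarrow> 'a set \<Rightarrow> real" where
  "swap_grad f x y A = f A - f (swap_sites x y A)"

text \<open>The division by \<open>2\<close> makes this the sum of the squared differences over the transitions along the edge
\<open>{x, y}\<close>, each counted once: every configuration with exactly one of the two sites occupied is
paired with its image.\<close>
definition swap_energy :: "'a set set \<Rightarrow> ('a set \<Rightarrow> real) \<Rightarrow> 'a \<Rightarrow> 'a \<Rightarrow> real" where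
  "swap_energy S f x y = (\<Sum>A\<in>S. (swap_grad f x y A)\<^sup>2) / 2"

lemma swap_grad_same [simp]: "swap_grad f x x = (\<lambda>_. 0)"
  by (simp add: swap_grad_def fun_eq_iff)

lemma swap_grad_sym: "swap_grad f x y = swap_grad f y x"
  by (simp add: swap_grad_def fun_eq_iff swap_sites_sym)

lemma swap_energy_same [simp]: "swap_energy S f x x = 0"
  by (simp add: swap_energy_def)

lemma swap_energy_sym: "swap_energy S f x y = swap_energy S f y x"
  by (simp add: swap_energy_def swap_grad_sym)

lemma swap_energy_nonneg: "0 \<le> swap_energy S f x y"
  by (simp add: swap_energy_def sum_nonneg)

text \<open>The map sending \<open>f\<close> to \<open>swap_grad f x y\<close> is self-adjoint and its square is twice itself, because the
swap is an involution.\<close>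
lemma sum_mult_swap_grad:
  assumes "\<And>A. A \<in> S \<Longrightarrow> swap_sites x y A \<in> S"
  shows "(\<Sum>A\<in>S. g A * swap_grad f x y A) = (\<Sum>A\<in>S. swap_grad g x y A * swap_grad f x y A) / 2"
proof -
  have "(\<Sum>A\<in>S. g A * swap_grad f x y A) = (\<Sum>A\<in>S. g (swap_sites x y A) * swap_grad f x y (swap_sites x y A))"
    by (rule sum_swap_sites[OF assms, symmetric]) simp
  also have "\<dots> = - (\<Sum>A\<in>S. g (swap_sites x y A) * swap_grad f x y A)"
    by (simp add: swap_grad_def sum_negf[symmetric] algebra_simps)
  finally show ?thesis
    by (simp add: swap_grad_def[of g] left_diff_distrib sum_subtractf)
qed

lemma sum_Pow_insert:
  assumes "finite V" "x \<notin> V"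
  shows "(\<Sum>A\<in>Pow (insert x V). F A) = (\<Sum>A\<in>Pow V. F A + F (insert x A))"
proof -
  have "(\<Sum>A\<in>Pow (insert x V). F A) = (\<Sum>A\<in>Pow V. F A) + (\<Sum>A\<in>insert x ` Pow V. F A)"
    unfolding Pow_insert using assms by (intro sum.union_disjoint) auto
  also have "(\<Sum>A\<in>insert x ` Pow V. F A) = (\<Sum>A\<in>Pow V. F (insert x A))"
    using assms by (subst sum.reindex) (auto simp: inj_on_def insert_ident subset_iff)
  finally show ?thesis by (simp add: sum.distrib)
qed

lemma sum_Pow_three:
  assumes "finite V" "x \<in> V" "y \<in> V" "z \<in> V" "distinct [x, y, z]"
  shows "(\<Sum>A\<in>Pow V. F A) = (\<Sum>T\<in>Pow (V - {x, y, z}).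
     F T + F (insert x T) + F (insert y T) + F (insert z T) + F (insert x (insert y T))
      + F (insert x (insert z T)) + F (insert y (insert z T)) + F (insert x (insert y (insert z T))))"
proof -
  define U where "U = V - {x, y, z}"
  have V: "V = insert z (insert y (insert x U))" and fin: "finite U"
    and nin: "x \<notin> U" "y \<notin> U" "z \<notin> U"
    using assms by (auto simp: U_def)
  show ?thesis unfolding U_def[symmetric] unfolding V
    using assms(5) fin nin
    by (simp add: sum_Pow_insert insert_commute algebra_simps)
qed

text \<open>The identity holds separately over each configuration of the other sites. If exactly one of the
three sites is occupied and \<open>a\<close>, \<open>b\<close>, \<open>c\<close> are the values of \<open>f\<close> as the particle sits at \<open>x\<close>, \<open>y\<close>, \<open>z\<close>,
it reads \<open>(a - b) (a - c) = ((a - b)\<^sup>2 + (a - c)\<^sup>2 - (b - c)\<^sup>2) / 2\<close>; two particles are the same case with a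
moving hole. It fails for three kinds of sites, so it uses that particles are indistinguishable.\<close>
lemma three_point_identity:
  assumes "finite V" "x \<in> V" "y \<in> V" "z \<in> V" "distinct [x, y, z]"
  shows "(\<Sum>A\<in>Pow V. swap_grad f x y A * swap_grad f x z A)
    = (swap_energy (Pow V) f x y + swap_energy (Pow V) f x z - swap_energy (Pow V) f y z) / 2"
  unfolding swap_energy_def sum_Pow_three[OF assms] sum_divide_distrib
    sum_subtractf[symmetric] sum.distrib[symmetric] 
proof (rule sum.cong[OF refl], goal_cases)
  case (1 T)
  then have nin: "x \<notin> T" "y \<notin> T" "z \<notin> T" by auto
  have d: "x \<noteq> y" "x \<noteq> z" "y \<noteq> z" "y \<noteq> x" "z \<noteq> x" "z \<noteq> y" using assms by auto
  from nin d show ?case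
    by (simp add: swap_grad_def swap_sites_alt insert_commute insert_Diff_if power2_eq_square field_simps)
qed

text \<open>A particle is carried from \<open>y\<close> to \<open>z\<close> by two jumps via \<open>x\<close>, in the order that the content of \<open>x\<close>
permits. For distinguishable particles three transpositions would be needed and the constant would
be worse than the one required for \<open>swap_corr_five_point\<close>.\<close>
lemma swap_energy_triangle:
  assumes "finite V" "x \<in> V" "y \<in> V" "z \<in> V" "distinct [x, y, z]"
  shows "swap_energy (Pow V) f y z \<le> 2 * (swap_energy (Pow V) f y x + swap_energy (Pow V) f x z)"
  unfolding swap_energy_def sum_Pow_three[OF assms] sum_divide_distrib sum_distrib_left
    sum_subtractf[symmetric] sum.distrib[symmetric]
proof (rule sum_mono, goal_cases)
  case (1 T)
  then have nin: "x \<notin> T" "y \<notin> T" "z \<notin> T" by auto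
  have d: "x \<noteq> y" "x \<noteq> z" "y \<noteq> z" "y \<noteq> x" "z \<noteq> x" "z \<noteq> y" using assms by auto
  have *: "(a - b)\<^sup>2 \<le> 2 * (a - c)\<^sup>2 + 2 * (c - b)\<^sup>2" for a b c :: real
    using zero_le_power2[of "a + b - 2 * c"] by (simp add: power2_eq_square algebra_simps)
  from nin d show ?case
    using *[of "f (insert y T)" "f (insert z T)" "f (insert x T)"]
      *[of "f (insert x (insert y T))" "f (insert x (insert z T))" "f (insert y (insert z T))"]
    by (simp add: swap_grad_def swap_sites_alt insert_commute insert_Diff_if power2_commute add_divide_distrib)
qed

section \<open>The octopus inequality\<close>
definition swap_corr :: "'a set \<Rightarrow> ('a set \<Rightarrow> real) \<Rightarrow> 'a \<Rightarrow> 'a \<Rightarrow> 'a \<Rightarrow> 'a \<Rightarrow> real" where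
  "swap_corr V f x y z w = (\<Sum>A\<in>Pow V. swap_grad f x y A * swap_grad f z w A)"

lemma swap_corr_sym:
  "swap_corr V f x y z w = swap_corr V f z w x y"
  "swap_corr V f x y z w = swap_corr V f y x z w"
  "swap_corr V f x y z w = swap_corr V f x y w z"
  by (simp_all add: swap_corr_def mult.commute swap_grad_sym[of f x y] swap_grad_sym[of f z w])

lemma swap_corr_same [simp]: "swap_corr V f x x z w = 0" "swap_corr V f x y z z = 0"
  by (simp_all add: swap_corr_def)

lemma swap_corr_diag: "swap_corr V f x y x y = 2 * swap_energy (Pow V) f x y"
  by (simp add: swap_corr_def swap_energy_def power2_eq_square)

text \<open>Swaps of disjoint pairs commute, so their correlation is a squared norm; in particular it is
nonnegative.\<close>
lemma swap_corr_disjoint: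
  assumes "x \<in> V" "y \<in> V" "z \<in> V" "w \<in> V" "{x, y} \<inter> {z, w} = {}"
  shows "swap_corr V f x y z w = swap_energy (Pow V) (swap_grad f x y) z w / 2"
proof -
  have grads: "swap_grad (swap_grad f z w) x y A = swap_grad (swap_grad f x y) z w A" for A
    using swap_sites_comm[OF assms(5), of A] by (simp add: swap_grad_def)
  have stable: "swap_sites a b A \<in> Pow V" if "A \<in> Pow V" "a \<in> V" "b \<in> V" for a b A
    using that swap_sites_subset[of a V b A] by simp
  have "swap_corr V f x y z w = (\<Sum>A\<in>Pow V. swap_grad f z w A * swap_grad f x y A)"
    by (simp add: swap_corr_def mult.commute)
  also have "\<dots> = (\<Sum>A\<in>Pow V. swap_grad (swap_grad f x y) z w A * swap_grad f x y A) / 2"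
    unfolding grads[symmetric] by (intro sum_mult_swap_grad stable assms)
  also have "(\<Sum>A\<in>Pow V. swap_grad (swap_grad f x y) z w A * swap_grad f x y A)
      = (\<Sum>A\<in>Pow V. swap_grad f x y A * swap_grad (swap_grad f x y) z w A)"
    by (simp add: mult.commute)
  also have "\<dots> = swap_energy (Pow V) (swap_grad f x y) z w"
    unfolding swap_energy_def power2_eq_square by (intro sum_mult_swap_grad stable assms)
  finally show ?thesis .
qed

text \<open>The triangle inequality for the function \<open>swap_grad f x y\<close> bounds the left-hand side by twice the sum
of the last two terms, the one for \<open>swap_grad f z w\<close> by twice the sum of the first two; the claim is
their average.\<close>
lemma swap_corr_five_point:
  assumes "finite V" "{hub, x, y, z, w} \<subseteq> V" "distinct [hub, x, y, z, w]"
  shows "swap_corr V f x y z w \<le> swap_corr V f hub y z w + swap_corr V f x hub z w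
     + swap_corr V f x y hub w + swap_corr V f x y z hub"
proof -
  have half: "swap_corr V f a b p q \<le> 2 * (swap_corr V f a b p r + swap_corr V f a b r q)"
    if "{a, b, p, q, r} \<subseteq> V" "distinct [a, b, p, q, r]" for a b p q r
  proof -
    have "distinct [r, p, q]" "{a, b} \<inter> {p, q} = {}" "{a, b} \<inter> {p, r} = {}" "{a, b} \<inter> {r, q} = {}"
      using that by auto
    then show ?thesis
      using swap_energy_triangle[of V r p q "swap_grad f a b"] that assms(1)
      by (simp add: swap_corr_disjoint)
  qed
  have "distinct [x, y, z, w, hub]" "distinct [z, w, x, y, hub]"
      "{x, y, z, w, hub} \<subseteq> V" "{z, w, x, y, hub} \<subseteq> V"
    using assms by auto
  from half[OF this(3,1)] half[OF this(4,2)] show ?thesis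
    by (simp add: swap_corr_sym(1)[of V f z w])
qed

definition distinct_corr :: "'a set \<Rightarrow> ('a set \<Rightarrow> real) \<Rightarrow> 'a \<Rightarrow> 'a \<Rightarrow> 'a \<Rightarrow> 'a \<Rightarrow> real" where
  "distinct_corr V f x y z w = (if distinct [x, y, z, w] then swap_corr V f x y z w else 0)"

lemma distinct_corr_nonneg:
  assumes "x \<in> V" "y \<in> V" "z \<in> V" "w \<in> V"
  shows "0 \<le> distinct_corr V f x y z w"
  using assms by (auto simp: distinct_corr_def swap_corr_disjoint swap_energy_nonneg)

lemma distinct_corr_five_point:
  assumes "finite V" "hub \<in> V" "{x, y, z, w} \<subseteq> V - {hub}"
  shows "distinct_corr V f x y z w \<le> distinct_corr V f hub y z w + distinct_corr V f x hub z w
     + distinct_corr V f x y hub w + distinct_corr V f x y z hub"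
proof (cases "distinct [x, y, z, w]")
  case True
  then have "distinct [hub, x, y, z, w]" "distinct [hub, y, z, w]" "distinct [x, hub, z, w]"
      "distinct [x, y, hub, w]" "distinct [x, y, z, hub]"
    using assms by auto
  then show ?thesis
    using swap_corr_five_point[of V hub x y z w f] assms True
    unfolding distinct_corr_def by auto
next
  case False
  then show ?thesis
    using assms distinct_corr_nonneg[of _ V]
    by (simp only: distinct_corr_def[of V f x y z w] if_False) (intro add_nonneg_nonneg distinct_corr_nonneg; auto)
qed

text \<open>The Gromov product of \<open>y\<close> and \<open>z\<close> at \<open>x\<close> for the squared distance \<open>swap_energy\<close>.\<close>
definition gromov_energy :: "'a set \<Rightarrow> ('a set \<Rightarrow> real) \<Rightarrow> 'a \<Rightarrow> 'a \<Rightarrow> 'a \<Rightarrow> real" where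
  "gromov_energy V f x y z
     = (swap_energy (Pow V) f x y + swap_energy (Pow V) f x z - swap_energy (Pow V) f y z) / 2"

text \<open>Correlations of overlapping swaps are Gromov products. The degenerate tuples need no correction: when
\<open>{z, w} = {x, y}\<close> two of the four terms are present and add up to \<open>2 * swap_energy\<close>, the squared norm of
the gradient, while for \<open>x = y\<close> or \<open>z = w\<close> the terms vanish or cancel.\<close>
lemma swap_corr_decompose:
  fixes V f
  defines "T \<equiv> gromov_energy V f"
  assumes "finite V" "x \<in> V" "y \<in> V" "z \<in> V" "w \<in> V"
  shows "swap_corr V f x y z w = distinct_corr V f x y z w
     + (if z = x then T x y w else 0) + (if w = x then T x y z else 0)
     + (if z = y then T y x w else 0) + (if w = y then T y x z else 0)"
proof -
  have three: "swap_corr V f a b a c = T a b c" if "distinct [a, b, c]" "{a, b, c} \<subseteq> V" for a b c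
    using three_point_identity[of V a b c f] that assms(2) by (simp add: swap_corr_def gromov_energy_def T_def)
  have Tbb: "T a b b = swap_energy (Pow V) f a b" "T a a b = 0" "T a b a = 0" for a b
    by (simp_all add: gromov_energy_def T_def swap_energy_sym)
  consider "x = y" | "z = w" | "x \<noteq> y" "z \<noteq> w" "distinct [x, y, z, w]"
    | "x \<noteq> y" "z = x" "w = y" | "x \<noteq> y" "z = y" "w = x"
    | "z = x" "distinct [x, y, w]" | "w = x" "distinct [x, y, z]"
    | "z = y" "distinct [x, y, w]" | "w = y" "distinct [x, y, z]"
    by auto
  then show ?thesis
  proof cases
    case 1
    then show ?thesis by (auto simp: distinct_corr_def Tbb)
  next
    case 2
    then show ?thesis by (auto simp: distinct_corr_def gromov_energy_def T_def swap_energy_sym)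
  next
    case 3
    then show ?thesis by (auto simp: distinct_corr_def)
  next
    case 4
    then show ?thesis using swap_energy_sym[of "Pow V" f x y]
      by (auto simp: distinct_corr_def Tbb swap_corr_diag)
  next
    case 5
    then show ?thesis using swap_energy_sym[of "Pow V" f x y]
      by (auto simp: distinct_corr_def Tbb swap_corr_diag swap_corr_sym(3)[of V f x y y x])
  next
    case 6
    then show ?thesis using three[of x y w] assms by (auto simp: distinct_corr_def)
  next
    case 7
    then show ?thesis using three[of x y z] assms
      by (auto simp: distinct_corr_def swap_corr_sym(3)[of V f x y z x])
  next
    case 8
    then show ?thesis using three[of y x w] assms
      by (auto simp: distinct_corr_def swap_corr_sym(2)[of V f x y y w])
  next
    case 9
    then show ?thesis using three[of y x z] assms
      by (auto simp: distinct_corr_def swap_corr_sym(3)[of V f x y z y] swap_corr_sym(2)[of V f x y y z])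
  qed
qed


text \<open>The sum is the squared norm of \<open>\<Sum>x\<in>V. \<Sum>y\<in>V. b x * b y * swap_grad f x y\<close>.\<close>
lemma sum_swap_corr_nonneg:
  "0 \<le> (\<Sum>x\<in>V. \<Sum>y\<in>V. b x * b y * (\<Sum>z\<in>V. \<Sum>w\<in>V. b z * b w * swap_corr V f x y z w))"
proof -
  define u where "u A p = b (fst p) * b (snd p) * swap_grad f (fst p) (snd p) A" for A p
  have "0 \<le> (\<Sum>A\<in>Pow V. (\<Sum>p\<in>V \<times> V. u A p)\<^sup>2)"
    by (simp add: sum_nonneg)
  also have "\<dots> = (\<Sum>p\<in>V \<times> V. \<Sum>q\<in>V \<times> V. \<Sum>A\<in>Pow V. u A p * u A q)"
    unfolding power2_eq_square sum_product
    by (subst sum.swap, rule sum.cong[OF refl], rule sum.swap)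
  also have "\<dots> = (\<Sum>p\<in>V \<times> V. b (fst p) * b (snd p) * (\<Sum>q\<in>V \<times> V. b (fst q) * b (snd q)
      * swap_corr V f (fst p) (snd p) (fst q) (snd q)))"
    unfolding swap_corr_def sum_distrib_left u_def by (intro sum.cong refl) (simp add: mult_ac)
  finally show ?thesis
    by (simp add: sum.cartesian_product case_prod_unfold)
qed

text \<open>The Gromov products have three terms; when the weights have total zero, the two terms that do not
involve one of the summation indices drop out.\<close>
lemma sum_swap_corr_eq:
  assumes "finite V" and b0: "(\<Sum>x\<in>V. b x) = 0"
  shows "(\<Sum>x\<in>V. \<Sum>y\<in>V. b x * b y * (\<Sum>z\<in>V. \<Sum>w\<in>V. b z * b w * swap_corr V f x y z w))
    = (\<Sum>x\<in>V. \<Sum>y\<in>V. b x * b y * (\<Sum>z\<in>V. \<Sum>w\<in>V. b z * b w * distinct_corr V f x y z w))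
      - 2 * (\<Sum>x\<in>V. (b x)\<^sup>2) * (\<Sum>x\<in>V. \<Sum>y\<in>V. b x * b y * swap_energy (Pow V) f x y)"
proof -
  let ?T = "gromov_energy V f"
  let ?e = "swap_energy (Pow V) f"
  have delta1: "(\<Sum>z\<in>V. \<Sum>w\<in>V. b z * b w * (if z = x then t w else 0)) = b x * (\<Sum>w\<in>V. b w * t w)"
    if "x \<in> V" for x and t :: "'a \<Rightarrow> real"
  proof -
    have "(\<Sum>z\<in>V. \<Sum>w\<in>V. b z * b w * (if z = x then t w else 0))
        = (\<Sum>z\<in>V. if z = x then b x * (\<Sum>w\<in>V. b w * t w) else 0)"
      by (intro sum.cong refl) (simp add: sum_distrib_left mult_ac)
    then show ?thesis using that assms(1) by simp
  qed
  have delta2: "(\<Sum>z\<in>V. \<Sum>w\<in>V. b z * b w * (if w = x then t z else 0)) = b x * (\<Sum>w\<in>V. b w * t w)"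
    if "x \<in> V" for x and t :: "'a \<Rightarrow> real"
    by (subst sum.swap) (use delta1[OF that, of t] in \<open>simp add: mult_ac\<close>)
  have inner: "(\<Sum>z\<in>V. \<Sum>w\<in>V. b z * b w * swap_corr V f x y z w)
      = (\<Sum>z\<in>V. \<Sum>w\<in>V. b z * b w * distinct_corr V f x y z w)
        + 2 * b x * (\<Sum>w\<in>V. b w * ?T x y w) + 2 * b y * (\<Sum>w\<in>V. b w * ?T y x w)"
    if "x \<in> V" "y \<in> V" for x y
  proof -
    have "(\<Sum>z\<in>V. \<Sum>w\<in>V. b z * b w * swap_corr V f x y z w)
      = (\<Sum>z\<in>V. \<Sum>w\<in>V. b z * b w * distinct_corr V f x y z w
        + b z * b w * (if z = x then ?T x y w else 0) + b z * b w * (if w = x then ?T x y z else 0)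
        + b z * b w * (if z = y then ?T y x w else 0) + b z * b w * (if w = y then ?T y x z else 0))"
      using that assms(1) by (intro sum.cong refl) (simp only: swap_corr_decompose distrib_left)
    also have "\<dots> = (\<Sum>z\<in>V. \<Sum>w\<in>V. b z * b w * distinct_corr V f x y z w)
        + b x * (\<Sum>w\<in>V. b w * ?T x y w) + b x * (\<Sum>w\<in>V. b w * ?T x y w)
        + b y * (\<Sum>w\<in>V. b w * ?T y x w) + b y * (\<Sum>w\<in>V. b w * ?T y x w)"
      unfolding sum.distrib delta1[OF that(1)] delta1[OF that(2)] delta2[OF that(1)] delta2[OF that(2)] ..
    finally show ?thesis by simp
  qed
  have T: "(\<Sum>y\<in>V. b y * (\<Sum>w\<in>V. b w * ?T x y w)) = - (\<Sum>y\<in>V. \<Sum>w\<in>V. b y * b w * ?e y w) / 2" for x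
  proof -
    have "(\<Sum>y\<in>V. b y * (\<Sum>w\<in>V. b w * ?T x y w))
      = (\<Sum>y\<in>V. \<Sum>w\<in>V. (b y * ?e x y / 2) * b w + b y * (b w * ?e x w / 2) - b y * b w * ?e y w / 2)"
      unfolding sum_distrib_left gromov_energy_def by (intro sum.cong refl) (simp add: field_simps)
    also have "\<dots> = - (\<Sum>y\<in>V. \<Sum>w\<in>V. b y * b w * ?e y w / 2)"
      unfolding sum.distrib sum_subtractf sum_distrib_left[symmetric] sum_distrib_right[symmetric]
      by (simp add: b0)
    finally show ?thesis by (simp add: sum_divide_distrib sum_negf)
  qed
  define R where "R = (\<Sum>x\<in>V. \<Sum>y\<in>V. b x * b y * (b x * (\<Sum>w\<in>V. b w * ?T x y w)))"
  have R': "R = (\<Sum>x\<in>V. \<Sum>y\<in>V. b x * b y * (b y * (\<Sum>w\<in>V. b w * ?T y x w)))"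
    unfolding R_def by (subst sum.swap) (simp add: mult_ac)
  have "R = (\<Sum>x\<in>V. (b x)\<^sup>2 * (\<Sum>y\<in>V. b y * (\<Sum>w\<in>V. b w * ?T x y w)))"
    unfolding R_def sum_distrib_left by (intro sum.cong refl) (simp add: power2_eq_square mult_ac)
  also have "\<dots> = - (\<Sum>x\<in>V. (b x)\<^sup>2) * (\<Sum>y\<in>V. \<Sum>w\<in>V. b y * b w * ?e y w) / 2"
    unfolding T by (simp add: sum_distrib_right[symmetric] sum_negf sum_divide_distrib[symmetric])
  finally have R: "R = - (\<Sum>x\<in>V. (b x)\<^sup>2) * (\<Sum>y\<in>V. \<Sum>w\<in>V. b y * b w * ?e y w) / 2" .
  have "(\<Sum>x\<in>V. \<Sum>y\<in>V. b x * b y * (\<Sum>z\<in>V. \<Sum>w\<in>V. b z * b w * swap_corr V f x y z w))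
    = (\<Sum>x\<in>V. \<Sum>y\<in>V. b x * b y * (\<Sum>z\<in>V. \<Sum>w\<in>V. b z * b w * distinct_corr V f x y z w)
       + 2 * (b x * b y * (b x * (\<Sum>w\<in>V. b w * ?T x y w)))
       + 2 * (b x * b y * (b y * (\<Sum>w\<in>V. b w * ?T y x w))))"
    by (intro sum.cong refl, subst inner) (simp_all add: algebra_simps)
  also have "\<dots> = (\<Sum>x\<in>V. \<Sum>y\<in>V. b x * b y * (\<Sum>z\<in>V. \<Sum>w\<in>V. b z * b w * distinct_corr V f x y z w))
      + 2 * R + 2 * R"
    unfolding sum.distrib sum_distrib_left[symmetric] R_def[symmetric] R'[symmetric] ..
  finally show ?thesis by (simp add: R)
qed

text \<open>At most one index of a tuple of distinct sites is the hub. Expanding \<open>b hub = - (\<Sum>x\<in>W. b x)\<close> turns each of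
the four sums with one index at the hub into minus a sum over all quadruples of \<open>W\<close>, so that the
five-point inequality applies term by term.\<close>
lemma sum_distinct_corr_nonpos:
  assumes "finite W" "hub \<notin> W" and c: "\<And>x. x \<in> W \<Longrightarrow> 0 \<le> b x" and b0: "b hub = - (\<Sum>x\<in>W. b x)"
  defines "V \<equiv> insert hub W"
  shows "(\<Sum>x\<in>V. \<Sum>y\<in>V. b x * b y * (\<Sum>z\<in>V. \<Sum>w\<in>V. b z * b w * distinct_corr V f x y z w)) \<le> 0"
proof -
  let ?D = "distinct_corr V f"
  have D0: "?D hub hub z w = 0" "?D hub y hub w = 0" "?D hub y z hub = 0" "?D x hub hub w = 0"
    "?D x hub z hub = 0" "?D x y hub hub = 0" for x y z w
    by (simp_all add: distinct_corr_def)
  have pull: "(\<Sum>y\<in>W. b y * k) = - (b hub * k)" for k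
    by (simp add: b0 sum_distrib_right)
  define S1 where "S1 = (\<Sum>x\<in>W. \<Sum>y\<in>W. \<Sum>z\<in>W. \<Sum>w\<in>W. b x * b y * b z * b w * ?D hub y z w)"
  define S2 where "S2 = (\<Sum>x\<in>W. \<Sum>y\<in>W. \<Sum>z\<in>W. \<Sum>w\<in>W. b x * b y * b z * b w * ?D x hub z w)"
  define S3 where "S3 = (\<Sum>x\<in>W. \<Sum>y\<in>W. \<Sum>z\<in>W. \<Sum>w\<in>W. b x * b y * b z * b w * ?D x y hub w)"
  define S4 where "S4 = (\<Sum>x\<in>W. \<Sum>y\<in>W. \<Sum>z\<in>W. \<Sum>w\<in>W. b x * b y * b z * b w * ?D x y z hub)"
  have S1: "S1 = - (\<Sum>y\<in>W. \<Sum>z\<in>W. \<Sum>w\<in>W. b hub * b y * b z * b w * ?D hub y z w)"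
  proof -
    have "S1 = (\<Sum>x\<in>W. b x * (\<Sum>y\<in>W. \<Sum>z\<in>W. \<Sum>w\<in>W. b y * b z * b w * ?D hub y z w))"
      unfolding S1_def sum_distrib_left by (intro sum.cong refl) (simp add: mult_ac)
    then show ?thesis unfolding pull by (simp add: sum_distrib_left mult_ac)
  qed
  have S2: "S2 = - (\<Sum>x\<in>W. \<Sum>z\<in>W. \<Sum>w\<in>W. b x * b hub * b z * b w * ?D x hub z w)"
  proof -
    have "S2 = (\<Sum>x\<in>W. \<Sum>y\<in>W. b y * (\<Sum>z\<in>W. \<Sum>w\<in>W. b x * b z * b w * ?D x hub z w))"
      unfolding S2_def sum_distrib_left by (intro sum.cong refl) (simp add: mult_ac)
    then show ?thesis unfolding pull by (simp add: sum_distrib_left sum_negf mult_ac)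
  qed
  have S3: "S3 = - (\<Sum>x\<in>W. \<Sum>y\<in>W. \<Sum>w\<in>W. b x * b y * b hub * b w * ?D x y hub w)"
  proof -
    have "S3 = (\<Sum>x\<in>W. \<Sum>y\<in>W. \<Sum>z\<in>W. b z * (\<Sum>w\<in>W. b x * b y * b w * ?D x y hub w))"
      unfolding S3_def sum_distrib_left by (intro sum.cong refl) (simp add: mult_ac)
    then show ?thesis unfolding pull by (simp add: sum_distrib_left sum_negf mult_ac)
  qed
  have S4: "S4 = - (\<Sum>x\<in>W. \<Sum>y\<in>W. \<Sum>z\<in>W. b x * b y * b z * b hub * ?D x y z hub)"
  proof -
    have "S4 = (\<Sum>x\<in>W. \<Sum>y\<in>W. \<Sum>z\<in>W. \<Sum>w\<in>W. b w * (b x * b y * b z * ?D x y z hub))"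
      unfolding S4_def by (intro sum.cong refl) (simp add: mult_ac)
    then show ?thesis unfolding pull by (simp add: sum_negf mult_ac)
  qed
  have expand: "(\<Sum>x\<in>V. F x) = F hub + (\<Sum>x\<in>W. F x)" for F :: "'a \<Rightarrow> real"
    using assms(1,2) by (simp add: V_def)
  have "(\<Sum>x\<in>V. \<Sum>y\<in>V. b x * b y * (\<Sum>z\<in>V. \<Sum>w\<in>V. b z * b w * ?D x y z w))
    = (\<Sum>x\<in>V. \<Sum>y\<in>V. \<Sum>z\<in>V. \<Sum>w\<in>V. b x * b y * b z * b w * ?D x y z w)"
    unfolding sum_distrib_left by (simp only: mult.assoc)
  also have "\<dots> = (\<Sum>x\<in>W. \<Sum>y\<in>W. \<Sum>z\<in>W. \<Sum>w\<in>W. b x * b y * b z * b w * ?D x y z w)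
        - S1 - S2 - S3 - S4"
    unfolding expand S1 S2 S3 S4 by (simp add: D0 sum.distrib)
  also have "\<dots> = (\<Sum>x\<in>W. \<Sum>y\<in>W. \<Sum>z\<in>W. \<Sum>w\<in>W. b x * b y * b z * b w
      * (?D x y z w - (?D hub y z w + ?D x hub z w + ?D x y hub w + ?D x y z hub)))"
    unfolding S1_def S2_def S3_def S4_def
    by (simp only: right_diff_distrib distrib_left sum_subtractf sum.distrib)
  also have "\<dots> \<le> 0"
  proof (intro sum_nonpos)
    fix x y z w assume xyzw: "x \<in> W" "y \<in> W" "z \<in> W" "w \<in> W"
    then have "?D x y z w \<le> ?D hub y z w + ?D x hub z w + ?D x y hub w + ?D x y z hub"
      using assms by (intro distinct_corr_five_point) (auto simp: V_def)
    then show "b x * b y * b z * b w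
      * (?D x y z w - (?D hub y z w + ?D x hub z w + ?D x y hub w + ?D x y z hub)) \<le> 0"
      using c xyzw by (intro mult_nonneg_nonpos) auto
  qed
  finally show ?thesis .
qed

lemma octopus_balanced:
  assumes "finite W" "hub \<notin> W" and b: "\<And>x. x \<in> W \<Longrightarrow> 0 \<le> b x" and b0: "b hub = - (\<Sum>x\<in>W. b x)"
  defines "V \<equiv> insert hub W"
  shows "(\<Sum>x\<in>V. \<Sum>y\<in>V. b x * b y * swap_energy (Pow V) f x y) \<le> 0" (is "?E \<le> 0")
proof (cases "(\<Sum>x\<in>V. (b x)\<^sup>2) = 0")
  case True
  then have "\<forall>x\<in>V. b x = 0"
    using assms(1) by (simp add: V_def sum_nonneg_eq_0_iff sum_nonneg add_nonneg_eq_0_iff)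
  then show ?thesis by simp
next
  case False
  then have pos: "(\<Sum>x\<in>V. (b x)\<^sup>2) > 0"
    by (simp add: sum_nonneg order_le_neq_trans)
  have "(\<Sum>x\<in>V. b x) = 0" and "finite V" using assms(1,2) b0 by (simp_all add: V_def)
  with sum_swap_corr_nonneg[where V = V and b = b and f = f] sum_swap_corr_eq[where V = V and b = b and f = f]
    sum_distinct_corr_nonpos[OF assms(1-4), of f, folded V_def]
  have "2 * (\<Sum>x\<in>V. (b x)\<^sup>2) * ?E \<le> 0" by linarith
  then show ?thesis using pos by (simp add: mult_le_0_iff)
qed

text \<open>The octopus inequality of Caputo, Liggett and Richthammer, for functions of unlabelled
configurations: replacing a star by its electrically equivalent complete graph does not
increase the energy.\<close>
lemma octopus:
  assumes "finite W" "hub \<notin> W" and c: "\<And>x. x \<in> W \<Longrightarrow> 0 \<le> c x"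
  defines "C \<equiv> \<Sum>x\<in>W. c x"
  shows "(\<Sum>x\<in>W. \<Sum>y\<in>W. c x * c y / C * swap_energy (Pow (insert hub W)) f x y) / 2
     \<le> (\<Sum>x\<in>W. c x * swap_energy (Pow (insert hub W)) f hub x)"
proof (cases "C = 0")
  case True
  then show ?thesis using c by (simp add: sum_nonneg swap_energy_nonneg)
next
  case False
  then have C: "C > 0" using c by (simp add: C_def sum_nonneg order_le_neq_trans)
  define b where "b = c(hub := - C)"
  let ?e = "swap_energy (Pow (insert hub W)) f"
  have bW: "x \<in> W \<Longrightarrow> b x = c x" for x using assms(2) by (auto simp: b_def)
  have bo: "b hub = - C" by (simp add: b_def)
  have sym: "?e x hub = ?e hub x" if "x \<in> W" for x by (rule swap_energy_sym)
  have "(\<Sum>x\<in>insert hub W. \<Sum>y\<in>insert hub W. b x * b y * ?e x y) \<le> 0"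
    using assms by (intro octopus_balanced) (auto simp: bW b_def C_def intro!: sum.cong)
  also have "(\<Sum>x\<in>insert hub W. \<Sum>y\<in>insert hub W. b x * b y * ?e x y)
     = (\<Sum>x\<in>W. \<Sum>y\<in>W. c x * c y * ?e x y) - C * (\<Sum>x\<in>W. c x * ?e hub x)
        - C * (\<Sum>x\<in>W. c x * ?e hub x)"
  proof -
    have "(\<Sum>y\<in>insert hub W. b x * b y * ?e x y) = (\<Sum>y\<in>W. c x * c y * ?e x y) - C * (c x * ?e hub x)"
      if "x \<in> W" for x
      using assms(1,2) that by (simp add: bW bo sym)
    moreover have "(\<Sum>y\<in>insert hub W. b hub * b y * ?e hub y) = - C * (\<Sum>x\<in>W. c x * ?e hub x)"
      using assms(1,2) by (simp add: bW bo sum_distrib_left sum_negf mult.assoc)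
    ultimately show ?thesis
      using assms(1,2) by (simp add: sum_subtractf sum_distrib_left[symmetric])
  qed
  finally have "(\<Sum>x\<in>W. \<Sum>y\<in>W. c x * c y * ?e x y) / C / 2 \<le> (\<Sum>x\<in>W. c x * ?e hub x)"
    using C by (simp add: field_simps)
  then show ?thesis by (simp add: sum_divide_distrib)
qed

section \<open>Deleting a vertex from the network\<close>
lemma finite_exclusion_states [simp]: "finite V \<Longrightarrow> finite (exclusion_states V m)"
  by (rule finite_subset[of _ "Pow V"]) (auto simp: exclusion_states_def)

lemma swap_sites_exclusion_states:
  "A \<in> exclusion_states V m \<Longrightarrow> x \<in> V \<Longrightarrow> y \<in> V \<Longrightarrow> swap_sites x y A \<in> exclusion_states V m"
  using swap_sites_subset[of x V y A] by (simp add: exclusion_states_def)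

lemma sum_exclusion_states_insert:
  assumes "finite W" "r \<notin> W"
  shows "(\<Sum>A\<in>exclusion_states (insert r W) (Suc k). F A)
    = (\<Sum>A\<in>exclusion_states W (Suc k). F A) + (\<Sum>A\<in>exclusion_states W k. F (insert r A))"
proof -
  have fin: "finite A" if "A \<in> exclusion_states W j" for A j
    using that finite_subset[OF _ assms(1), of A] by (simp add: exclusion_states_def)
  have "exclusion_states (insert r W) (Suc k) = exclusion_states W (Suc k) \<union> insert r ` exclusion_states W k"
  proof (intro set_eqI iffI)
    fix A assume A: "A \<in> exclusion_states (insert r W) (Suc k)"
    show "A \<in> exclusion_states W (Suc k) \<union> insert r ` exclusion_states W k"
    proof (cases "r \<in> A")
      case True
      have "card (A - {r}) = k" "A - {r} \<subseteq> W"
        using A True by (auto simp: exclusion_states_def)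
      then show ?thesis
        using True by (intro UnI2 image_eqI[of _ _ "A - {r}"]) (simp_all add: insert_absorb exclusion_states_def)
    next
      case False
      then show ?thesis using A by (simp add: exclusion_states_def subset_insert)
    qed
  next
    fix A assume "A \<in> exclusion_states W (Suc k) \<union> insert r ` exclusion_states W k"
    then show "A \<in> exclusion_states (insert r W) (Suc k)"
    proof
      assume "A \<in> insert r ` exclusion_states W k"
      then obtain B where B: "A = insert r B" "B \<in> exclusion_states W k" by (rule imageE)
      then have "r \<notin> B" using assms(2) by (auto simp: exclusion_states_def)
      then show ?thesis using B fin[OF B(2)] by (auto simp: exclusion_states_def)
    qed (auto simp: exclusion_states_def)
  qed
  moreover have "exclusion_states W (Suc k) \<inter> insert r ` exclusion_states W k = {}"
    using assms(2) by (auto simp: exclusion_states_def)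
  moreover have "inj_on (insert r) (exclusion_states W k)"
  proof (rule inj_onI)
    fix A B assume "A \<in> exclusion_states W k" "B \<in> exclusion_states W k" "insert r A = insert r B"
    moreover from this have "r \<notin> A" "r \<notin> B" using assms(2) by (auto simp: exclusion_states_def)
    ultimately show "A = B" by (metis insert_ident)
  qed
  ultimately show ?thesis
    using assms(1) by (simp only: sum.union_disjoint finite_exclusion_states finite_imageI sum.reindex comp_def)
qed

text \<open>Swaps preserve the number of particles, so inequalities over all configurations restrict to those
with \<open>m\<close> particles by cutting off the function.\<close>
lemma swap_energy_exclusion_states_Pow:
  assumes "finite V"
  shows "swap_energy (Pow V) (\<lambda>A. if card A = m then f A else 0) x y = swap_energy (exclusion_states V m) f x y"
proof -
  have "(\<Sum>A\<in>Pow V. (swap_grad (\<lambda>A. if card A = m then f A else 0) x y A)\<^sup>2)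
      = (\<Sum>A\<in>Pow V. if card A = m then (swap_grad f x y A)\<^sup>2 else 0)"
    by (intro sum.cong refl) (simp add: swap_grad_def)
  also have "\<dots> = (\<Sum>A\<in>exclusion_states V m. (swap_grad f x y A)\<^sup>2)"
    using assms by (simp add: sum.inter_filter[symmetric] exclusion_states_def)
  finally show ?thesis by (simp add: swap_energy_def)
qed

lemma swap_energy_split:
  assumes "finite W" "r \<notin> W" "x \<in> W" "y \<in> W"
  shows "swap_energy (exclusion_states (insert r W) (Suc k)) f x y
    = swap_energy (exclusion_states W (Suc k)) f x y + swap_energy (exclusion_states W k) (\<lambda>A. f (insert r A)) x y"
proof -
  have "swap_sites x y (insert r A) = insert r (swap_sites x y A)" for A
    using assms by (auto simp: swap_sites_alt)
  then show ?thesis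
    using assms by (simp add: swap_energy_def swap_grad_def sum_exclusion_states_insert add_divide_distrib)
qed

definition rw_energy :: "'a set \<Rightarrow> ('a \<Rightarrow> 'a \<Rightarrow> real) \<Rightarrow> ('a \<Rightarrow> real) \<Rightarrow> real" where
  "rw_energy V w h = (\<Sum>x\<in>V. \<Sum>y\<in>V. w x y * (h x - h y)\<^sup>2) / 2"

definition rw_poincare :: "'a set \<Rightarrow> ('a \<Rightarrow> 'a \<Rightarrow> real) \<Rightarrow> real \<Rightarrow> bool" where
  "rw_poincare V w \<gamma> \<longleftrightarrow> (\<forall>h. (\<Sum>x\<in>V. h x) = 0 \<longrightarrow> \<gamma> * (\<Sum>x\<in>V. (h x)\<^sup>2) \<le> rw_energy V w h)"

definition exclusion_energy :: "'a set \<Rightarrow> ('a \<Rightarrow> 'a \<Rightarrow> real) \<Rightarrow> nat \<Rightarrow> ('a set \<Rightarrow> real) \<Rightarrow> real" where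
  "exclusion_energy V w m f = (\<Sum>x\<in>V. \<Sum>y\<in>V. w x y * swap_energy (exclusion_states V m) f x y) / 2"

text \<open>The star-mesh transform: the network on \<open>W\<close> with the same effective conductances as the network on
\<open>insert r W\<close>. If \<open>r\<close> has no edges, the divisor is \<open>0\<close> and the weights are unchanged.\<close>
definition reduced_weights :: "'a set \<Rightarrow> ('a \<Rightarrow> 'a \<Rightarrow> real) \<Rightarrow> 'a \<Rightarrow> 'a \<Rightarrow> 'a \<Rightarrow> real" where
  "reduced_weights W w r x y = w x y + w r x * w r y / (\<Sum>z\<in>W. w r z)"

lemma sum_insert_symmetric:
  fixes F :: "'a \<Rightarrow> 'a \<Rightarrow> real"
  assumes "finite W" "r \<notin> W" "F r r = 0" "\<And>x. x \<in> W \<Longrightarrow> F x r = F r x"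
  shows "(\<Sum>x\<in>insert r W. \<Sum>y\<in>insert r W. F x y) = (\<Sum>x\<in>W. \<Sum>y\<in>W. F x y) + 2 * (\<Sum>x\<in>W. F r x)"
  using assms by (simp add: sum.distrib)

text \<open>Swaps inside \<open>W\<close> do not see \<open>r\<close>, so the energy of the reduced network splits according to whether \<open>r\<close> is
vacant or occupied. The star around \<open>r\<close> is handled by the octopus inequality.\<close>
lemma exclusion_energy_reduced:
  assumes "finite W" "r \<notin> W" and nonneg: "\<And>x y. 0 \<le> w x y" and sym: "\<And>x y. w x y = w y x"
  shows "exclusion_energy W (reduced_weights W w r) (Suc k) f
      + exclusion_energy W (reduced_weights W w r) k (\<lambda>A. f (insert r A))
    \<le> exclusion_energy (insert r W) w (Suc k) f"
proof -
  let ?e = "swap_energy (exclusion_states (insert r W) (Suc k)) f"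
  have "(\<Sum>x\<in>W. \<Sum>y\<in>W. w r x * w r y / (\<Sum>z\<in>W. w r z) * ?e x y) / 2 \<le> (\<Sum>x\<in>W. w r x * ?e r x)"
    using octopus[OF assms(1,2), of "w r" "\<lambda>A. if card A = Suc k then f A else 0"] nonneg assms(1)
    by (simp add: swap_energy_exclusion_states_Pow)
  moreover have "(\<Sum>x\<in>insert r W. \<Sum>y\<in>insert r W. w x y * ?e x y)
      = (\<Sum>x\<in>W. \<Sum>y\<in>W. w x y * ?e x y) + 2 * (\<Sum>x\<in>W. w r x * ?e r x)"
    using assms(1,2) sym swap_energy_sym by (intro sum_insert_symmetric) (simp, simp, simp, subst sym, subst swap_energy_sym, simp)
  moreover have "exclusion_energy W (reduced_weights W w r) (Suc k) f
      + exclusion_energy W (reduced_weights W w r) k (\<lambda>A. f (insert r A))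
    = (\<Sum>x\<in>W. \<Sum>y\<in>W. reduced_weights W w r x y * ?e x y) / 2"
    using assms(1,2) unfolding exclusion_energy_def add_divide_distrib[symmetric] sum.distrib[symmetric]
    by (intro arg_cong2[where f = "(/)"] sum.cong refl) (simp add: swap_energy_split distrib_left)
  moreover have "(\<Sum>x\<in>W. \<Sum>y\<in>W. reduced_weights W w r x y * ?e x y)
      = (\<Sum>x\<in>W. \<Sum>y\<in>W. w x y * ?e x y) + (\<Sum>x\<in>W. \<Sum>y\<in>W. w r x * w r y / (\<Sum>z\<in>W. w r z) * ?e x y)"
    by (simp add: reduced_weights_def distrib_right sum.distrib)
  ultimately show ?thesis
    unfolding exclusion_energy_def[of "insert r W"] by linarith
qed

lemma sum_weighted_variance:
  fixes c h :: "'a \<Rightarrow> real"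
  assumes "C = (\<Sum>x\<in>W. c x)" "C \<noteq> 0"
  shows "(\<Sum>x\<in>W. c x * (h x - (\<Sum>y\<in>W. c y * h y) / C)\<^sup>2)
    = (\<Sum>x\<in>W. \<Sum>y\<in>W. c x * c y / C * (h x - h y)\<^sup>2) / 2"
proof -
  define M where "M = (\<Sum>y\<in>W. c y * h y)"
  define Q where "Q = (\<Sum>y\<in>W. c y * (h y)\<^sup>2)"
  have "(\<Sum>x\<in>W. c x * (h x - M / C)\<^sup>2) = (\<Sum>x\<in>W. c x * (h x)\<^sup>2 - 2 * (M / C) * (c x * h x) + (M / C)\<^sup>2 * c x)"
    by (intro sum.cong refl) (simp add: power2_eq_square algebra_simps)
  also have "\<dots> = Q - 2 * (M / C) * M + (M / C)\<^sup>2 * C"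
    by (simp only: sum.distrib sum_subtractf sum_distrib_left[symmetric] M_def Q_def assms(1))
  also have "\<dots> = Q - M * M / C"
    using assms(2) by (simp add: power2_eq_square)
  finally have 1: "(\<Sum>x\<in>W. c x * (h x - M / C)\<^sup>2) = Q - M * M / C" .
  have "(\<Sum>x\<in>W. \<Sum>y\<in>W. c x * c y / C * (h x - h y)\<^sup>2)
    = (\<Sum>x\<in>W. \<Sum>y\<in>W. (c x * (h x)\<^sup>2) * c y / C - 2 * ((c x * h x) * (c y * h y) / C) + c x * (c y * (h y)\<^sup>2) / C)"
    using assms(2) by (intro sum.cong refl) (simp add: power2_eq_square field_simps)
  also have "\<dots> = Q * C / C - 2 * (M * M / C) + C * Q / C"
    by (simp only: sum.distrib sum_subtractf sum_distrib_left[symmetric] sum_divide_distrib[symmetric]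
       sum_distrib_right[symmetric] M_def Q_def assms(1))
  finally show ?thesis
    using 1 assms(2) by (simp add: M_def)
qed

text \<open>The energy of \<open>h\<close> in the reduced network is that of its harmonic extension \<open>g\<close> to \<open>r\<close> in the original
one. The extension need not have mean zero, but centring it leaves a sum of squares at least that of
\<open>h\<close>.\<close>
lemma rw_poincare_reduced:
  assumes "finite W" "r \<notin> W" and nonneg: "\<And>x y. 0 \<le> w x y" and sym: "\<And>x y. w x y = w y x"
    and "0 \<le> \<gamma>" and poincare: "rw_poincare (insert r W) w \<gamma>"
  shows "rw_poincare W (reduced_weights W w r) \<gamma>"
  unfolding rw_poincare_def
proof (intro allI impI)
  fix h :: "'a \<Rightarrow> real" assume h0: "(\<Sum>x\<in>W. h x) = 0"
  define C where "C = (\<Sum>x\<in>W. w r x)"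
  \<comment> \<open>\<open>a\<close> is the harmonic value at \<open>r\<close>, and \<open>\<mu>\<close> the mean of the extension since \<open>h\<close> has total zero\<close>
  define a where "a = (\<Sum>x\<in>W. w r x * h x) / C"
  define \<mu> where "\<mu> = a / (card W + 1)"
  define g where "g = (\<lambda>x. h x - \<mu>)(r := a - \<mu>)"
  have g: "g r = a - \<mu>" "x \<in> W \<Longrightarrow> g x = h x - \<mu>" for x using assms(2) by (auto simp: g_def)
  have "(\<Sum>x\<in>insert r W. g x) = a - \<mu> * (card W + 1)"
    using assms(1,2) h0 by (simp add: g sum_subtractf algebra_simps)
  also have "\<dots> = 0" by (simp add: \<mu>_def)
  finally have "\<gamma> * (\<Sum>x\<in>insert r W. (g x)\<^sup>2) \<le> rw_energy (insert r W) w g"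
    using poincare by (simp add: rw_poincare_def)
  moreover have "(\<Sum>x\<in>W. (h x)\<^sup>2) \<le> (\<Sum>x\<in>insert r W. (g x)\<^sup>2)"
  proof -
    have "(\<Sum>x\<in>W. (h x - \<mu>)\<^sup>2) = (\<Sum>x\<in>W. (h x)\<^sup>2 - 2 * \<mu> * h x + \<mu>\<^sup>2)"
      by (intro sum.cong refl) (simp add: power2_eq_square algebra_simps)
    also have "\<dots> = (\<Sum>x\<in>W. (h x)\<^sup>2) + card W * \<mu>\<^sup>2"
      by (simp add: sum.distrib sum_subtractf sum_distrib_left[symmetric] h0)
    finally show ?thesis using assms(1,2) by (simp add: g)
  qed
  then have "\<gamma> * (\<Sum>x\<in>W. (h x)\<^sup>2) \<le> \<gamma> * (\<Sum>x\<in>insert r W. (g x)\<^sup>2)"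
    using assms(5) by (rule mult_left_mono)
  moreover have "rw_energy (insert r W) w g = rw_energy W (reduced_weights W w r) h"
  proof -
    have "(\<Sum>x\<in>insert r W. \<Sum>y\<in>insert r W. w x y * (g x - g y)\<^sup>2)
      = (\<Sum>x\<in>W. \<Sum>y\<in>W. w x y * (g x - g y)\<^sup>2) + 2 * (\<Sum>x\<in>W. w r x * (g r - g x)\<^sup>2)"
      using assms(1,2) by (intro sum_insert_symmetric) (simp, simp, simp, subst sym, subst power2_commute, simp)
    also have "(\<Sum>x\<in>W. \<Sum>y\<in>W. w x y * (g x - g y)\<^sup>2) = (\<Sum>x\<in>W. \<Sum>y\<in>W. w x y * (h x - h y)\<^sup>2)"
      by (intro sum.cong refl) (simp add: g)
    also have "(\<Sum>x\<in>W. w r x * (g r - g x)\<^sup>2) = (\<Sum>x\<in>W. w r x * (h x - a)\<^sup>2)"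
      by (intro sum.cong refl) (simp add: g power2_commute)
    also have "\<dots> = (\<Sum>x\<in>W. \<Sum>y\<in>W. w r x * w r y / C * (h x - h y)\<^sup>2) / 2"
    proof (cases "C = 0")
      case True
      then have "w r x = 0" if "x \<in> W" for x
        using that assms(1) nonneg unfolding C_def by (subst (asm) sum_nonneg_eq_0_iff) auto
      then show ?thesis by simp
    next
      case False
      then show ?thesis unfolding a_def by (intro sum_weighted_variance C_def)
    qed
    finally show ?thesis
      by (simp add: rw_energy_def reduced_weights_def C_def distrib_right sum.distrib)
  qed
  ultimately show "\<gamma> * (\<Sum>x\<in>W. (h x)\<^sup>2) \<le> rw_energy W (reduced_weights W w r) h" by linarith
qed

section \<open>Functions linear in the occupation numbers\<close>
definition site_sum :: "('a \<Rightarrow> real) \<Rightarrow> 'a set \<Rightarrow> real" where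
  "site_sum h A = (\<Sum>x\<in>A. h x)"

lemma swap_grad_site_sum:
  assumes "finite A"
  shows "swap_grad (site_sum h) x y A = (h x - h y) * (of_bool (x \<in> A) - of_bool (y \<in> A))"
proof -
  have *: "sum h (insert b (A - {a})) = sum h A - h a + h b" if "a \<in> A" "b \<notin> A" for a b
    using that assms by (simp add: sum_diff1)
  show ?thesis
    using *[of x y] *[of y x] by (auto simp: swap_grad_def site_sum_def swap_sites_alt)
qed

lemma card_states_separating:
  assumes "finite V" "x \<in> V" "y \<in> V" "x \<noteq> y" "1 \<le> m"
  shows "card {A \<in> exclusion_states V m. x \<in> A \<and> y \<notin> A} = (card V - 2) choose (m - 1)"
proof -
  let ?U = "V - {x, y}"
  have fin: "finite ?U" using assms(1) by simp
  have "{A \<in> exclusion_states V m. x \<in> A \<and> y \<notin> A} = insert x ` {T. T \<subseteq> ?U \<and> card T = m - 1}"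
  proof (intro set_eqI iffI)
    fix A assume A: "A \<in> {A \<in> exclusion_states V m. x \<in> A \<and> y \<notin> A}"
    then have "A - {x} \<in> {T. T \<subseteq> ?U \<and> card T = m - 1}"
      by (auto simp: exclusion_states_def)
    then show "A \<in> insert x ` {T. T \<subseteq> ?U \<and> card T = m - 1}"
      using A by (intro image_eqI[of _ _ "A - {x}"]) (simp_all add: insert_absorb)
  next
    fix A assume "A \<in> insert x ` {T. T \<subseteq> ?U \<and> card T = m - 1}"
    then obtain T where T: "A = insert x T" "T \<subseteq> ?U" "card T = m - 1" by blast
    then have "card A = m"
      using finite_subset[OF T(2) fin] assms(5) by (subst T(1), subst card_insert_disjoint) auto
    then show "A \<in> {A \<in> exclusion_states V m. x \<in> A \<and> y \<notin> A}"
      using T(1,2) assms by (auto simp: exclusion_states_def)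
  qed
  moreover have "inj_on (insert x) {T. T \<subseteq> ?U \<and> card T = m - 1}"
  proof (rule inj_onI)
    fix A B assume "A \<in> {T. T \<subseteq> ?U \<and> card T = m - 1}" "B \<in> {T. T \<subseteq> ?U \<and> card T = m - 1}"
      "insert x A = insert x B"
    moreover from this have "x \<notin> A" "x \<notin> B" by auto
    ultimately show "A = B" by (metis insert_ident)
  qed
  moreover have "card ?U = card V - 2"
    using assms by (subst card_Diff_subset) auto
  ultimately show ?thesis using n_subsets[OF fin] by (simp add: card_image)
qed

text \<open>Since \<open>h\<close> has total zero, its sum over the occupied sites is minus its sum over the vacant sites, so only
the configurations that separate \<open>x\<close> from another site have to be counted.\<close>
lemma sum_site_sum_occupied:
  assumes "finite V" "x \<in> V" "1 \<le> m" and h0: "(\<Sum>y\<in>V. h y) = 0"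
  shows "(\<Sum>A\<in>exclusion_states V m. of_bool (x \<in> A) * site_sum h A) = real ((card V - 2) choose (m - 1)) * h x"
proof -
  let ?S = "exclusion_states V m"
  let ?b = "real ((card V - 2) choose (m - 1))"
  have "of_bool (x \<in> A) * site_sum h A = - (\<Sum>y\<in>V - {x}. h y * of_bool (x \<in> A \<and> y \<notin> A))" if "A \<in> ?S" for A
  proof (cases "x \<in> A")
    case True
    have "A \<subseteq> V" using that by (simp add: exclusion_states_def)
    then have "site_sum h A = - (\<Sum>y\<in>V - A. h y)"
      using h0 sum.subset_diff[of A V h] assms(1) by (simp add: site_sum_def)
    also have "(\<Sum>y\<in>V - A. h y) = (\<Sum>y\<in>V - {x}. h y * of_bool (y \<notin> A))"
      using assms(1) True by (intro sum.mono_neutral_cong_left) auto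
    finally show ?thesis using True by simp
  qed simp
  then have "(\<Sum>A\<in>?S. of_bool (x \<in> A) * site_sum h A)
      = - (\<Sum>y\<in>V - {x}. h y * (\<Sum>A\<in>?S. of_bool (x \<in> A \<and> y \<notin> A)))"
    by (simp add: sum_negf sum_distrib_left sum.swap[of _ ?S])
  also have "(\<Sum>y\<in>V - {x}. h y * (\<Sum>A\<in>?S. of_bool (x \<in> A \<and> y \<notin> A))) = (\<Sum>y\<in>V - {x}. h y * ?b)"
  proof (intro sum.cong refl)
    fix y assume "y \<in> V - {x}"
    then have "card {A \<in> ?S. x \<in> A \<and> y \<notin> A} = (card V - 2) choose (m - 1)"
      using assms by (intro card_states_separating) auto
    moreover have "(\<Sum>A\<in>?S. of_bool (x \<in> A \<and> y \<notin> A)) = real (card {A \<in> ?S. x \<in> A \<and> y \<notin> A})"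
      using assms(1) by (simp add: of_bool_def sum.inter_filter[symmetric])
    ultimately show "h y * (\<Sum>A\<in>?S. of_bool (x \<in> A \<and> y \<notin> A)) = h y * ?b" by simp
  qed
  also have "(\<Sum>y\<in>V - {x}. h y * ?b) = - h x * ?b"
  proof -
    have "(\<Sum>y\<in>V - {x}. h y) = - h x"
      using h0 sum.remove[of V x h] assms(1,2) by simp
    then show ?thesis by (simp only: sum_distrib_right[symmetric])
  qed
  finally show ?thesis by simp
qed

lemma swap_energy_site_sum:
  assumes "finite V" "x \<in> V" "y \<in> V" "1 \<le> m"
  shows "swap_energy (exclusion_states V m) (site_sum h) x y = real ((card V - 2) choose (m - 1)) * (h x - h y)\<^sup>2"
proof (cases "x = y")
  case False
  let ?S = "exclusion_states V m"
  have fin: "finite A" if "A \<in> ?S" for A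
    using that finite_subset[OF _ assms(1), of A] by (simp add: exclusion_states_def)
  have "(\<Sum>A\<in>?S. (swap_grad (site_sum h) x y A)\<^sup>2)
     = (\<Sum>A\<in>?S. (h x - h y)\<^sup>2 * of_bool (x \<in> A \<and> y \<notin> A) + (h x - h y)\<^sup>2 * of_bool (y \<in> A \<and> x \<notin> A))"
    by (intro sum.cong refl) (auto simp: swap_grad_site_sum fin power_mult_distrib)
  also have "\<dots> = (h x - h y)\<^sup>2 * card {A \<in> ?S. x \<in> A \<and> y \<notin> A} + (h x - h y)\<^sup>2 * card {A \<in> ?S. y \<in> A \<and> x \<notin> A}"
    using assms(1) by (simp add: sum.distrib sum_distrib_left[symmetric] of_bool_def sum.inter_filter[symmetric])
  finally show ?thesis
    using card_states_separating[OF assms(1-3) _ assms(4)] card_states_separating[OF assms(1,3,2) _ assms(4)] False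
    by (simp add: swap_energy_def)
qed simp

lemma sum_mult_site_sum:
  assumes "finite V"
  shows "(\<Sum>A\<in>exclusion_states V m. f A * site_sum h A)
    = (\<Sum>x\<in>V. h x * (\<Sum>A\<in>exclusion_states V m. of_bool (x \<in> A) * f A))"
proof -
  let ?S = "exclusion_states V m"
  have "(\<Sum>A\<in>?S. f A * site_sum h A) = (\<Sum>A\<in>?S. \<Sum>x\<in>V. h x * (of_bool (x \<in> A) * f A))"
  proof (rule sum.cong[OF refl])
    fix A assume "A \<in> ?S"
    then have "A \<subseteq> V" by (simp add: exclusion_states_def)
    then have "site_sum h A = (\<Sum>x\<in>V. of_bool (x \<in> A) * h x)"
      using assms unfolding site_sum_def by (intro sum.mono_neutral_cong_left) auto
    then show "f A * site_sum h A = (\<Sum>x\<in>V. h x * (of_bool (x \<in> A) * f A))"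
      by (simp add: sum_distrib_left mult_ac)
  qed
  also have "\<dots> = (\<Sum>x\<in>V. \<Sum>A\<in>?S. h x * (of_bool (x \<in> A) * f A))" by (rule sum.swap)
  finally show ?thesis by (simp only: sum_distrib_left)
qed

text \<open>The orthogonal projection onto linear functions: \<open>sum_site_sum_occupied\<close> says that on functions with
total zero the relevant Gram matrix is a multiple of the identity, which is inverted by dividing by
a binomial coefficient.\<close>
lemma site_sum_projection:
  assumes "finite V" "1 \<le> m" "m < card V" and f0: "(\<Sum>A\<in>exclusion_states V m. f A) = 0"
  obtains h where "(\<Sum>x\<in>V. h x) = 0"
    "\<And>x. x \<in> V \<Longrightarrow> (\<Sum>A\<in>exclusion_states V m. of_bool (x \<in> A) * (f A - site_sum h A)) = 0"
proof -
  let ?S = "exclusion_states V m"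
  define b where "b = real ((card V - 2) choose (m - 1))"
  have b: "b > 0" using assms(2,3) by (simp add: b_def)
  define G where "G x = (\<Sum>A\<in>?S. of_bool (x \<in> A) * f A)" for x
  have "(\<Sum>x\<in>V. G x) = (\<Sum>A\<in>?S. f A * site_sum (\<lambda>_. 1) A)"
    unfolding G_def sum_mult_site_sum[OF assms(1)] by simp
  also have "\<dots> = (\<Sum>A\<in>?S. f A * real m)"
    by (intro sum.cong refl) (simp add: site_sum_def exclusion_states_def)
  also have "\<dots> = 0" by (simp only: sum_distrib_right[symmetric] f0)
  finally have "(\<Sum>x\<in>V. G x / b) = 0" by (simp add: sum_divide_distrib[symmetric])
  moreover have "(\<Sum>A\<in>?S. of_bool (x \<in> A) * (f A - site_sum (\<lambda>x. G x / b) A)) = 0" if "x \<in> V" for x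
    using sum_site_sum_occupied[OF assms(1) that assms(2) calculation, folded b_def] b
    by (simp add: right_diff_distrib sum_subtractf G_def[symmetric])
  ultimately show ?thesis by (rule that)
qed

text \<open>The gradient of a linear function is again linear, so it is orthogonal to \<open>f\<close>, and the cross term is
zero for each edge separately.\<close>
lemma swap_energy_add_site_sum:
  assumes "finite V" "x \<in> V" "y \<in> V"
    and f0: "\<And>x. x \<in> V \<Longrightarrow> (\<Sum>A\<in>exclusion_states V m. of_bool (x \<in> A) * f A) = 0"
  shows "swap_energy (exclusion_states V m) (\<lambda>A. f A + site_sum h A) x y
    = swap_energy (exclusion_states V m) f x y + swap_energy (exclusion_states V m) (site_sum h) x y"
proof -
  let ?S = "exclusion_states V m"
  have fin: "finite A" if "A \<in> ?S" for A
    using that finite_subset[OF _ assms(1), of A] by (simp add: exclusion_states_def)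
  have "(\<Sum>A\<in>?S. swap_grad f x y A * swap_grad (site_sum h) x y A) / 2
      = (\<Sum>A\<in>?S. f A * swap_grad (site_sum h) x y A)"
    using assms by (intro sum_mult_swap_grad[symmetric] swap_sites_exclusion_states)
  also have "\<dots> = (\<Sum>A\<in>?S. (h x - h y) * (of_bool (x \<in> A) * f A) - (h x - h y) * (of_bool (y \<in> A) * f A))"
    by (intro sum.cong refl) (simp add: swap_grad_site_sum fin algebra_simps)
  also have "\<dots> = 0"
    by (simp only: sum_subtractf sum_distrib_left[symmetric] f0 assms(2,3))
  finally have cross: "(\<Sum>A\<in>?S. swap_grad f x y A * swap_grad (site_sum h) x y A) = 0" by simp
  have "(\<Sum>A\<in>?S. (swap_grad (\<lambda>A. f A + site_sum h A) x y A)\<^sup>2)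
      = (\<Sum>A\<in>?S. (swap_grad f x y A)\<^sup>2 + (swap_grad (site_sum h) x y A)\<^sup>2
          + 2 * (swap_grad f x y A * swap_grad (site_sum h) x y A))"
    by (intro sum.cong refl) (simp add: swap_grad_def power2_eq_square algebra_simps)
  also have "\<dots> = (\<Sum>A\<in>?S. (swap_grad f x y A)\<^sup>2) + (\<Sum>A\<in>?S. (swap_grad (site_sum h) x y A)\<^sup>2)"
    by (simp only: sum.distrib sum_distrib_left[symmetric] cross)
  finally show ?thesis by (simp add: swap_energy_def add_divide_distrib)
qed

section \<open>From one particle to many\<close>
lemma reduced_weights_nonneg:
  "(\<And>x y. 0 \<le> w x y) \<Longrightarrow> 0 \<le> reduced_weights W w r x y"
  by (simp add: reduced_weights_def sum_nonneg)

lemma reduced_weights_sym: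
  "(\<And>x y. w x y = w y x) \<Longrightarrow> reduced_weights W w r x y = reduced_weights W w r y x"
  by (simp add: reduced_weights_def mult.commute)

lemma exclusion_energy_nonneg:
  "(\<And>x y. 0 \<le> w x y) \<Longrightarrow> 0 \<le> exclusion_energy V w m f"
  by (simp add: exclusion_energy_def sum_nonneg swap_energy_nonneg)

text \<open>The exclusion case of Aldous' spectral gap conjecture, in the form of Poincare inequalities. The
weights are general, because the induction leaves the class of unweighted graphs.\<close>
theorem exclusion_poincare:
  assumes "finite V" "\<And>x y. 0 \<le> w x y" "\<And>x y. w x y = w y x" "0 \<le> \<gamma>"
    "rw_poincare V w \<gamma>" "(\<Sum>A\<in>exclusion_states V m. f A) = 0"
  shows "\<gamma> * (\<Sum>A\<in>exclusion_states V m. (f A)\<^sup>2) \<le> exclusion_energy V w m f"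
  using assms
proof (induction V arbitrary: w m f rule: finite_induct)
  case empty
  then show ?case
  proof -
    have "exclusion_states ({} :: 'a set) m = (if m = 0 then {{}} else {})"
      by (auto simp: exclusion_states_def)
    then show ?thesis using empty.prems(5) by (simp add: exclusion_energy_def split: if_splits)
  qed
next
  case (insert r W)
  let ?V = "insert r W"
  let ?S = "exclusion_states ?V m"
  have finV: "finite ?V" using insert.hyps by simp
  have E0: "0 \<le> exclusion_energy ?V w m f"
    using insert.prems(1) by (rule exclusion_energy_nonneg)
  have single: ?case if "?S \<subseteq> {A}" for A
  proof -
    have "(\<Sum>A\<in>?S. (f A)\<^sup>2) = 0"
      using that insert.prems(5) subset_singletonD[OF that] by auto
    then show ?thesis using E0 by simp
  qed
  consider "m = 0" | "m \<ge> card ?V" | k where "m = Suc k" "m < card ?V"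
    by (cases m) force+
  then show ?case
  proof cases
    case 1
    show ?thesis by (rule single[of "{}"]) (use 1 finV in \<open>auto simp: exclusion_states_def dest: finite_subset\<close>)
  next
    case 2
    have "A = ?V" if "A \<in> ?S" for A
      using that 2 finV by (intro card_seteq) (auto simp: exclusion_states_def)
    then show ?thesis by (intro single[of ?V]) blast
  next
    case (3 k)
    let ?b = "real ((card ?V - 2) choose (m - 1))"
    let ?w = "reduced_weights W w r"
    have m: "1 \<le> m" using 3 by simp
    obtain h where h0: "(\<Sum>x\<in>?V. h x) = 0"
      and occ: "\<And>x. x \<in> ?V \<Longrightarrow> (\<Sum>A\<in>?S. of_bool (x \<in> A) * (f A - site_sum h A)) = 0"
      using site_sum_projection[OF finV m 3(2) insert.prems(5)] by metis
    \<comment> \<open>the part orthogonal to linear functions: conditionally on the content of any site it has total zero\<close>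
    define g where "g A = f A - site_sum h A" for A
    have occ_g: "(\<Sum>A\<in>?S. of_bool (x \<in> A) * g A) = 0" if "x \<in> ?V" for x
      using occ[OF that] by (simp add: g_def)
    have f: "f = (\<lambda>A. g A + site_sum h A)" by (simp add: g_def)
    have "real m * (\<Sum>A\<in>?S. g A) = (\<Sum>A\<in>?S. g A * site_sum (\<lambda>_. 1) A)"
      unfolding sum_distrib_left by (intro sum.cong refl) (simp add: site_sum_def exclusion_states_def)
    also have "\<dots> = 0"
      unfolding sum_mult_site_sum[OF finV] by (rule sum.neutral) (simp add: occ_g)
    finally have total: "(\<Sum>A\<in>?S. g A) = 0" using m by simp
    have linear: "\<gamma> * (\<Sum>A\<in>?S. (site_sum h A)\<^sup>2) \<le> exclusion_energy ?V w m (site_sum h)"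
    proof -
      have "(\<Sum>A\<in>?S. (site_sum h A)\<^sup>2) = (\<Sum>x\<in>?V. h x * (?b * h x))"
        unfolding power2_eq_square
        by (subst sum_mult_site_sum[OF finV], intro sum.cong refl)
          (simp only: sum_site_sum_occupied[OF finV _ m h0])
      also have "\<dots> = ?b * (\<Sum>x\<in>?V. (h x)\<^sup>2)"
        unfolding sum_distrib_left by (intro sum.cong refl) (simp only: power2_eq_square mult_ac)
      finally have "\<gamma> * (\<Sum>A\<in>?S. (site_sum h A)\<^sup>2) = ?b * (\<gamma> * (\<Sum>x\<in>?V. (h x)\<^sup>2))"
        by (simp only: mult_ac)
      also have "\<dots> \<le> ?b * rw_energy ?V w h"
        using insert.prems(4) h0 unfolding rw_poincare_def by (intro mult_left_mono) auto
      also have "\<dots> = exclusion_energy ?V w m (site_sum h)"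
        unfolding rw_energy_def exclusion_energy_def times_divide_eq_right sum_distrib_left
        by (intro arg_cong2[where f = "(/)"] sum.cong refl)
          (simp only: swap_energy_site_sum[OF finV _ _ m] mult_ac)
      finally show ?thesis .
    qed
    have rest: "\<gamma> * (\<Sum>A\<in>?S. (g A)\<^sup>2) \<le> exclusion_energy ?V w m g"
    proof -
      note split = sum_exclusion_states_insert[OF insert.hyps, where k = k, folded 3(1)]
      have zero: "of_bool (r \<in> A) * g A = 0" if "A \<in> exclusion_states W m" for A
        using that insert.hyps(2) by (auto simp: exclusion_states_def)
      have "(\<Sum>A\<in>?S. of_bool (r \<in> A) * g A) = (\<Sum>A\<in>exclusion_states W k. g (insert r A))"
        unfolding split by (simp add: zero)
      then have occupied: "(\<Sum>A\<in>exclusion_states W k. g (insert r A)) = 0"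
        using occ_g[of r] by simp
      with total have vacant: "(\<Sum>A\<in>exclusion_states W m. g A) = 0"
        unfolding split by simp
      have pw: "rw_poincare W ?w \<gamma>"
        using insert.hyps insert.prems(1-4) by (intro rw_poincare_reduced)
      note IH = insert.IH[OF reduced_weights_nonneg reduced_weights_sym insert.prems(3) pw,
          OF insert.prems(1,2)]
      have "\<gamma> * (\<Sum>A\<in>?S. (g A)\<^sup>2) = \<gamma> * (\<Sum>A\<in>exclusion_states W m. (g A)\<^sup>2)
          + \<gamma> * (\<Sum>A\<in>exclusion_states W k. (g (insert r A))\<^sup>2)"
        unfolding split by (rule distrib_left)
      also have "\<dots> \<le> exclusion_energy W ?w m g + exclusion_energy W ?w k (\<lambda>A. g (insert r A))"
        by (intro add_mono IH vacant occupied)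
      also have "\<dots> \<le> exclusion_energy ?V w m g"
        unfolding 3(1) using insert.hyps insert.prems(1,2) by (intro exclusion_energy_reduced)
      finally show ?thesis .
    qed
    have "(\<Sum>A\<in>?S. g A * site_sum h A) = 0"
      unfolding sum_mult_site_sum[OF finV] by (rule sum.neutral) (simp add: occ_g)
    moreover have "(\<Sum>A\<in>?S. (f A)\<^sup>2)
        = (\<Sum>A\<in>?S. (g A)\<^sup>2 + (site_sum h A)\<^sup>2 + 2 * (g A * site_sum h A))"
      unfolding f by (intro sum.cong refl) (simp add: power2_eq_square algebra_simps)
    ultimately have "(\<Sum>A\<in>?S. (f A)\<^sup>2) = (\<Sum>A\<in>?S. (g A)\<^sup>2) + (\<Sum>A\<in>?S. (site_sum h A)\<^sup>2)"
      by (simp only: sum.distrib sum_distrib_left[symmetric])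
    moreover have "exclusion_energy ?V w m f = exclusion_energy ?V w m g + exclusion_energy ?V w m (site_sum h)"
      unfolding exclusion_energy_def add_divide_distrib[symmetric] sum.distrib[symmetric] f
      by (intro arg_cong2[where f = "(/)"] sum.cong refl)
        (simp only: swap_energy_add_site_sum[OF finV _ _ occ_g] distrib_left)
    ultimately show ?thesis using linear rest by (simp add: distrib_left)
  qed
qed

section \<open>The random walk on a path\<close>
definition cos_gap :: "nat \<Rightarrow> real" where
  "cos_gap L = 2 - 2 * cos (pi / (real L + 1))"

lemma cos_gap_pos: "1 \<le> L \<Longrightarrow> 0 < cos_gap L"
  using cos_monotone_0_pi[of 0 "pi / (real L + 1)"] by (simp add: cos_gap_def field_simps)

lemma cos_gap_nonneg: "0 \<le> cos_gap L"
  by (simp add: cos_gap_def)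

text \<open>A discrete Picone inequality, to be summed with \<open>s\<close> and \<open>t\<close> consecutive values of a positive
eigenfunction. The hypotheses on zeros cover the two ends of the path, where \<open>x / 0 = 0\<close>.\<close>
lemma picone_pointwise:
  fixes a b s t :: real
  assumes "0 \<le> s" "0 \<le> t" "s = 0 \<Longrightarrow> a = 0" "t = 0 \<Longrightarrow> b = 0"
  shows "a\<^sup>2 * (1 - t / s) + b\<^sup>2 * (1 - s / t) \<le> (b - a)\<^sup>2"
proof (cases "s = 0 \<or> t = 0")
  case True
  then show ?thesis using assms(3,4) by auto
next
  case False
  then have st: "s > 0" "t > 0" using assms(1,2) by auto
  then have "(b - a)\<^sup>2 - (a\<^sup>2 * (1 - t / s) + b\<^sup>2 * (1 - s / t)) = (a * t - b * s)\<^sup>2 / (s * t)"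
    by (simp add: power2_eq_square field_simps)
  moreover have "0 \<le> (a * t - b * s)\<^sup>2 / (s * t)" using st by simp
  ultimately show ?thesis by linarith
qed

text \<open>The sine is positive inside the path and satisfies \<open>s (k - 1) + s (k + 1) = (2 - cos_gap L) * s k\<close>, so the
Picone inequality sums up to the Poincare inequality for zero boundary values.\<close>
lemma path_poincare_dirichlet:
  fixes H :: "nat \<Rightarrow> real"
  assumes "H 0 = 0" "H (Suc L) = 0"
  shows "cos_gap L * (\<Sum>k<Suc L. (H k)\<^sup>2) \<le> (\<Sum>k<Suc L. (H (Suc k) - H k)\<^sup>2)"
proof -
  define \<theta> where "\<theta> = pi / (real L + 1)"
  define s where "s k = sin (real k * \<theta>)" for k
  have \<theta>L: "real (Suc L) * \<theta> = pi" by (simp add: \<theta>_def field_simps)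
  have \<theta>pos: "\<theta> > 0" by (simp add: \<theta>_def)
  have s_pos: "s k > 0" if "0 < k" "k < Suc L" for k
  proof -
    have "real k * \<theta> < real (Suc L) * \<theta>" using that \<theta>pos by (intro mult_strict_right_mono) auto
    then show ?thesis using that \<theta>pos unfolding s_def \<theta>L by (intro sin_gt_zero) auto
  qed
  have s0: "s 0 = 0" "s (Suc L) = 0" unfolding s_def \<theta>L by simp_all
  have s_nonneg: "0 \<le> s k" if "k \<le> Suc L" for k
    using s_pos[of k] s0 that by (cases "k = 0"; cases "k = Suc L") auto
  have s_zero: "H k = 0" if "k \<le> Suc L" "s k = 0" for k
    using s_pos[of k] assms that by (cases "k = 0"; cases "k = Suc L") auto
  define G where "G k = (H k)\<^sup>2 * (1 - s (k - 1) / s k)" for k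
  have "(\<Sum>k<Suc L. G (Suc k)) = (\<Sum>k<Suc L. G k)"
    using sum.lessThan_Suc_shift[of G "Suc L"] assms by (simp add: G_def)
  then have "(\<Sum>k<Suc L. (H k)\<^sup>2 * (1 - s (Suc k) / s k)) + (\<Sum>k<Suc L. (H (Suc k))\<^sup>2 * (1 - s k / s (Suc k)))
      = (\<Sum>k<Suc L. (H k)\<^sup>2 * (1 - s (Suc k) / s k) + G k)"
    by (simp add: G_def sum.distrib)
  also have "\<dots> = (\<Sum>k<Suc L. cos_gap L * (H k)\<^sup>2)"
  proof (intro sum.cong refl)
    fix k assume k: "k \<in> {..<Suc L}"
    show "(H k)\<^sup>2 * (1 - s (Suc k) / s k) + G k = cos_gap L * (H k)\<^sup>2"
    proof (cases k)
      case 0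
      then show ?thesis using assms by (simp add: G_def)
    next
      case (Suc j)
      have eq: "s (Suc k) + s j = 2 * cos \<theta> * s k"
        unfolding s_def Suc using sin_add[of "(real j + 1) * \<theta>" \<theta>] sin_diff[of "(real j + 1) * \<theta>" \<theta>]
        by (simp add: algebra_simps)
      have "s k > 0" using s_pos[of k] Suc k by simp
      then have "(1 - s (Suc k) / s k) + (1 - s j / s k) = 2 - (s (Suc k) + s j) / s k"
        by (simp add: field_simps)
      also have "\<dots> = cos_gap L" using \<open>s k > 0\<close> by (simp add: eq cos_gap_def \<theta>_def)
      finally have "(H k)\<^sup>2 * ((1 - s (Suc k) / s k) + (1 - s j / s k)) = (H k)\<^sup>2 * cos_gap L" by simp
      then show ?thesis by (simp add: G_def Suc algebra_simps)
    qed
  qed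
  finally have "cos_gap L * (\<Sum>k<Suc L. (H k)\<^sup>2) = (\<Sum>k<Suc L. (H k)\<^sup>2 * (1 - s (Suc k) / s k) + (H (Suc k))\<^sup>2 * (1 - s k / s (Suc k)))"
    by (simp only: sum_distrib_left sum.distrib)
  also have "\<dots> \<le> (\<Sum>k<Suc L. (H (Suc k) - H k)\<^sup>2)"
    by (intro sum_mono picone_pointwise s_nonneg s_zero) auto
  finally show ?thesis .
qed

text \<open>The partial sums \<open>H\<close> of \<open>h\<close> vanish at both ends, and summation by parts relates \<open>H\<close> to the increments of
\<open>h\<close>. This duality transfers the inequality from zero boundary values to mean zero: expand
\<open>0 \<le> \<Sum> (h (i + 1) - h i + cos_gap L * H (i + 1))\<^sup>2\<close>.\<close>
lemma path_poincare_nat: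
  fixes h :: "nat \<Rightarrow> real"
  assumes h0: "(\<Sum>i<Suc L. h i) = 0"
  shows "cos_gap L * (\<Sum>i<Suc L. (h i)\<^sup>2) \<le> (\<Sum>i<L. (h (Suc i) - h i)\<^sup>2)"
proof -
  let ?g = "cos_gap L"
  define H where "H k = (\<Sum>i<k. h i)" for k
  have HS: "H (Suc k) - H k = h k" for k by (simp add: H_def)
  have abel: "(\<Sum>i<Suc n. (h i)\<^sup>2) = H (Suc n) * h n - (\<Sum>i<n. H (Suc i) * (h (Suc i) - h i))" for n
  proof (induction n)
    case (Suc n)
    have "H (Suc (Suc n)) = H (Suc n) + h (Suc n)" using HS[of "Suc n"] by simp
    then show ?case using Suc by (simp add: algebra_simps power2_eq_square)
  qed (simp add: H_def power2_eq_square)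
  define X where "X = (\<Sum>i<Suc L. (h i)\<^sup>2)"
  define Y where "Y = (\<Sum>i<L. (H (Suc i))\<^sup>2)"
  define D where "D = (\<Sum>i<L. (h (Suc i) - h i)\<^sup>2)"
  have "?g * (\<Sum>k<Suc L. (H k)\<^sup>2) \<le> X"
    using path_poincare_dirichlet[of H L] h0 by (simp add: HS X_def) (simp add: H_def)
  then have Y: "?g * Y \<le> X"
    unfolding Y_def using sum.lessThan_Suc_shift[of "\<lambda>k. (H k)\<^sup>2" L] by (simp add: H_def)
  have X: "(\<Sum>i<L. H (Suc i) * (h (Suc i) - h i)) = - X"
    using abel[of L] h0 by (simp add: X_def H_def)
  have "0 \<le> (\<Sum>i<L. ((h (Suc i) - h i) + ?g * H (Suc i))\<^sup>2)"
    by (simp add: sum_nonneg)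
  also have "\<dots> = (\<Sum>i<L. (h (Suc i) - h i)\<^sup>2 + 2 * ?g * (H (Suc i) * (h (Suc i) - h i)) + ?g * ?g * (H (Suc i))\<^sup>2)"
    by (intro sum.cong refl) (simp add: power2_eq_square algebra_simps)
  also have "\<dots> = D - 2 * ?g * X + ?g * (?g * Y)"
    by (simp only: sum.distrib sum_distrib_left[symmetric] X D_def Y_def)
  also have "\<dots> \<le> D - 2 * ?g * X + ?g * X"
    using Y cos_gap_nonneg by (intro add_left_mono mult_left_mono)
  finally show ?thesis by (simp add: X_def D_def)
qed

definition path_weight :: "int \<Rightarrow> int \<Rightarrow> real" where
  "path_weight s t = of_bool (\<bar>s - t\<bar> = 1)"

lemma rw_energy_path:
  "rw_energy {0..int L} path_weight h = (\<Sum>i<L. (h (int (Suc i)) - h (int i))\<^sup>2)"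
proof (induction L)
  case 0
  then show ?case by (simp add: rw_energy_def)
next
  case (Suc L)
  let ?I = "{0..int L}" and ?r = "int (Suc L)"
  let ?F = "\<lambda>s t. path_weight s t * (h s - h t)\<^sup>2"
  have I: "{0..int (Suc L)} = insert ?r ?I" by auto
  have "(\<Sum>s\<in>?I. ?F ?r s) = (\<Sum>s\<in>?I. if s = int L then (h ?r - h s)\<^sup>2 else 0)"
    by (intro sum.cong refl) (auto simp: path_weight_def)
  then have "(\<Sum>s\<in>?I. ?F ?r s) = (h ?r - h (int L))\<^sup>2" by simp
  moreover have "(\<Sum>s\<in>insert ?r ?I. \<Sum>t\<in>insert ?r ?I. ?F s t) = (\<Sum>s\<in>?I. \<Sum>t\<in>?I. ?F s t) + 2 * (\<Sum>s\<in>?I. ?F ?r s)"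
    by (intro sum_insert_symmetric) (auto simp: path_weight_def abs_minus_commute power2_commute)
  ultimately show ?case using Suc unfolding rw_energy_def I by simp
qed

lemma rw_poincare_path: "rw_poincare {0..int L} path_weight (cos_gap L)"
  unfolding rw_poincare_def
proof (intro allI impI)
  fix h :: "int \<Rightarrow> real" assume h0: "(\<Sum>x\<in>{0..int L}. h x) = 0"
  have reindex: "(\<Sum>x\<in>{0..int L}. F x) = (\<Sum>i<Suc L. F (int i))" for F :: "int \<Rightarrow> real"
    by (rule sum.reindex_bij_witness[of _ int nat]) auto
  show "cos_gap L * (\<Sum>x\<in>{0..int L}. (h x)\<^sup>2) \<le> rw_energy {0..int L} path_weight h"
    using path_poincare_nat[of "\<lambda>i. h (int i)" L] h0 unfolding reindex rw_energy_path by simp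
qed

section \<open>The random walk in a box\<close>
lemma rw_energy_shift: "rw_energy V w (\<lambda>x. h x - a) = rw_energy V w h"
  by (simp add: rw_energy_def)

text \<open>Split \<open>k\<close> into its averages \<open>M\<close> over the second factor and the deviations from them. The deviations are
controlled by the inequality on \<open>I\<close>, the averages by the one on \<open>V\<close>, and averaging does not increase the
energy.\<close>
lemma rw_poincare_product:
  fixes k :: "'a \<Rightarrow> 'b \<Rightarrow> real"
  assumes "finite V" "finite I" "I \<noteq> {}" "0 \<le> \<gamma>" and nonneg: "\<And>x y. 0 \<le> w x y"
    and V: "rw_poincare V w \<gamma>" and I: "rw_poincare I p \<gamma>" and k0: "(\<Sum>g\<in>V. \<Sum>s\<in>I. k g s) = 0"
  shows "\<gamma> * (\<Sum>g\<in>V. \<Sum>s\<in>I. (k g s)\<^sup>2)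
    \<le> (\<Sum>s\<in>I. rw_energy V w (\<lambda>g. k g s)) + (\<Sum>g\<in>V. rw_energy I p (k g))"
proof -
  define n where "n = real (card I)"
  have n: "n > 0" using assms(2,3) by (simp add: n_def card_gt_0_iff)
  have variance: "(\<Sum>s\<in>I. (a s)\<^sup>2) = (\<Sum>s\<in>I. (a s - (\<Sum>s\<in>I. a s) / n)\<^sup>2) + n * ((\<Sum>s\<in>I. a s) / n)\<^sup>2"
    for a :: "'b \<Rightarrow> real"
  proof -
    define A where "A = (\<Sum>s\<in>I. a s)"
    have "(\<Sum>s\<in>I. (a s - A / n)\<^sup>2) = (\<Sum>s\<in>I. (a s)\<^sup>2 - 2 * (A / n) * a s + (A / n)\<^sup>2)"
      by (intro sum.cong refl) (simp add: power2_eq_square algebra_simps)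
    also have "\<dots> = (\<Sum>s\<in>I. (a s)\<^sup>2) - 2 * (A / n) * A + n * (A / n)\<^sup>2"
      by (simp only: sum.distrib sum_subtractf sum_distrib_left[symmetric] A_def n_def sum_constant)
    also have "\<dots> = (\<Sum>s\<in>I. (a s)\<^sup>2) - n * (A / n)\<^sup>2"
      using n by (simp add: power2_eq_square field_simps)
    finally show ?thesis by (simp add: A_def)
  qed
  define M where "M g = (\<Sum>s\<in>I. k g s) / n" for g
  have "(\<Sum>g\<in>V. M g) = 0" using k0 by (simp add: M_def sum_divide_distrib[symmetric])
  then have "\<gamma> * (\<Sum>g\<in>V. (M g)\<^sup>2) \<le> rw_energy V w M" using V by (simp add: rw_poincare_def)
  then have "n * (\<gamma> * (\<Sum>g\<in>V. (M g)\<^sup>2)) \<le> n * rw_energy V w M" using n by (intro mult_left_mono) auto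
  also have "\<dots> \<le> (\<Sum>s\<in>I. rw_energy V w (\<lambda>g. k g s))"
  proof -
    have jensen: "n * (M g - M g')\<^sup>2 \<le> (\<Sum>s\<in>I. (k g s - k g' s)\<^sup>2)" for g g'
      using variance[of "\<lambda>s. k g s - k g' s"]
      by (simp add: M_def sum_subtractf diff_divide_distrib sum_nonneg)
    have "n * rw_energy V w M = (\<Sum>g\<in>V. \<Sum>g'\<in>V. w g g' * (n * (M g - M g')\<^sup>2)) / 2"
      by (simp add: rw_energy_def sum_distrib_left mult_ac)
    also have "\<dots> \<le> (\<Sum>g\<in>V. \<Sum>g'\<in>V. w g g' * (\<Sum>s\<in>I. (k g s - k g' s)\<^sup>2)) / 2"
      using nonneg jensen by (intro divide_right_mono sum_mono mult_left_mono) auto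
    also have "\<dots> = (\<Sum>s\<in>I. \<Sum>g\<in>V. \<Sum>g'\<in>V. w g g' * (k g s - k g' s)\<^sup>2) / 2"
      unfolding sum_distrib_left by (simp only: sum.swap[of _ I V])
    finally show ?thesis by (simp add: rw_energy_def sum_divide_distrib)
  qed
  finally have mean: "n * (\<gamma> * (\<Sum>g\<in>V. (M g)\<^sup>2)) \<le> (\<Sum>s\<in>I. rw_energy V w (\<lambda>g. k g s))" .
  have fibre: "\<gamma> * (\<Sum>s\<in>I. (k g s - M g)\<^sup>2) \<le> rw_energy I p (k g)" for g
  proof -
    have "(\<Sum>s\<in>I. k g s - M g) = 0" using n by (simp add: sum_subtractf M_def n_def[symmetric])
    then have "\<gamma> * (\<Sum>s\<in>I. (k g s - M g)\<^sup>2) \<le> rw_energy I p (\<lambda>s. k g s - M g)"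
      using I by (simp add: rw_poincare_def)
    then show ?thesis by (simp add: rw_energy_shift)
  qed
  have "\<gamma> * (\<Sum>g\<in>V. \<Sum>s\<in>I. (k g s)\<^sup>2)
      = (\<Sum>g\<in>V. \<gamma> * (\<Sum>s\<in>I. (k g s - M g)\<^sup>2)) + n * (\<gamma> * (\<Sum>g\<in>V. (M g)\<^sup>2))"
    by (subst variance) (simp add: M_def[symmetric] sum.distrib sum_distrib_left[symmetric] distrib_left mult_ac)
  also have "\<dots> \<le> (\<Sum>g\<in>V. rw_energy I p (k g)) + (\<Sum>s\<in>I. rw_energy V w (\<lambda>g. k g s))"
    by (intro add_mono sum_mono fibre mean)
  finally show ?thesis by simp
qed

definition lattice_weight :: "nat \<Rightarrow> (nat \<Rightarrow> int) \<Rightarrow> (nat \<Rightarrow> int) \<Rightarrow> real" where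
  "lattice_weight d x y = of_bool (nearest_neighbours d x y)"

lemma nearest_neighbours_sym: "nearest_neighbours d x y \<longleftrightarrow> nearest_neighbours d y x"
  unfolding nearest_neighbours_def by (metis abs_minus_commute)

lemma nearest_neighbours_irrefl: "\<not> nearest_neighbours d x x"
  by (simp add: nearest_neighbours_def)

lemma finite_box_verts [simp]: "finite (box_verts d L)"
  by (simp add: box_verts_def finite_PiE)

lemma card_box_verts: "card (box_verts d L) = (L + 1) ^ d"
  by (simp add: box_verts_def card_PiE nat_add_distrib)

lemma sum_box_verts_Suc:
  "(\<Sum>x\<in>box_verts (Suc d) L. F x) = (\<Sum>g\<in>box_verts d L. \<Sum>s\<in>{0..int L}. F (g(d := s)))"
proof -
  have "box_verts (Suc d) L = (\<lambda>(s, g). g(d := s)) ` ({0..int L} \<times> box_verts d L)"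
    unfolding box_verts_def lessThan_Suc by (rule PiE_insert_eq)
  moreover have "inj_on (\<lambda>(s, g). g(d := s)) ({0..int L} \<times> box_verts d L)"
    unfolding box_verts_def by (rule inj_combinator) simp
  ultimately have "(\<Sum>x\<in>box_verts (Suc d) L. F x) = (\<Sum>(s, g)\<in>{0..int L} \<times> box_verts d L. F (g(d := s)))"
    by (simp add: sum.reindex case_prod_unfold)
  also have "\<dots> = (\<Sum>s\<in>{0..int L}. \<Sum>g\<in>box_verts d L. F (g(d := s)))"
    by (simp add: sum.cartesian_product)
  finally show ?thesis by (simp only: sum.swap[of _ "{0..int L}"])
qed

lemma lattice_weight_Suc:
  assumes "g \<in> box_verts d L" "g' \<in> box_verts d L"
  shows "lattice_weight (Suc d) (g(d := s)) (g'(d := t))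
    = of_bool (s = t) * lattice_weight d g g' + of_bool (g = g') * path_weight s t"
proof -
  have ext: "g = g'" if "\<forall>i<d. g i = g' i"
    using assms that unfolding box_verts_def by (intro PiE_ext) auto
  have "nearest_neighbours (Suc d) (g(d := s)) (g'(d := t))
      \<longleftrightarrow> (s = t \<and> nearest_neighbours d g g') \<or> (g = g' \<and> \<bar>s - t\<bar> = 1)"
    (is "?L \<longleftrightarrow> ?R")
  proof
    assume ?L
    then obtain k where k: "k < Suc d" "\<bar>(g(d := s)) k - (g'(d := t)) k\<bar> = 1"
      and eq: "\<And>i. i < Suc d \<Longrightarrow> i \<noteq> k \<Longrightarrow> (g(d := s)) i = (g'(d := t)) i"
      unfolding nearest_neighbours_def by blast
    show ?R
    proof (cases "k = d")
      case True
      have "g i = g' i" if "i < d" for i using eq[of i] that True by simp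
      then show ?thesis using ext k True by simp
    next
      case False
      then have kd: "k < d" using k by simp
      have "g i = g' i" if "i < d" "i \<noteq> k" for i using eq[of i] that by simp
      moreover have "s = t" using eq[of d] False by simp
      ultimately show ?thesis using k kd unfolding nearest_neighbours_def by auto
    qed
  next
    assume ?R
    then show ?L
    proof
      assume *: "s = t \<and> nearest_neighbours d g g'"
      then obtain k where "k < d" "\<bar>g k - g' k\<bar> = 1" "\<forall>i<d. i \<noteq> k \<longrightarrow> g i = g' i"
        unfolding nearest_neighbours_def by blast
      then show ?L using * unfolding nearest_neighbours_def by (intro exI[of _ k]) auto
    next
      assume "g = g' \<and> \<bar>s - t\<bar> = 1"
      then show ?L unfolding nearest_neighbours_def by (intro exI[of _ d]) auto
    qed
  qed
  moreover have "\<not> (nearest_neighbours d g g' \<and> g = g')"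
    using nearest_neighbours_irrefl by blast
  ultimately show ?thesis
    by (auto simp: lattice_weight_def path_weight_def of_bool_def)
qed

lemma sum_of_bool_eq:
  assumes "finite V" "g \<in> V"
  shows "(\<Sum>x\<in>V. of_bool (g = x) * F x) = (F g :: real)"
  using assms by (simp add: of_bool_def if_distrib[of "\<lambda>c. c * _"] cong: if_cong)

lemma sum_lattice_weight_Suc:
  assumes "g \<in> box_verts d L" "s \<in> {0..int L}"
  shows "(\<Sum>y\<in>box_verts (Suc d) L. lattice_weight (Suc d) (g(d := s)) y * F y)
    = (\<Sum>g'\<in>box_verts d L. lattice_weight d g g' * F (g'(d := s)))
      + (\<Sum>t\<in>{0..int L}. path_weight s t * F (g(d := t)))"
proof -
  let ?V = "box_verts d L" and ?I = "{0..int L}"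
  have "(\<Sum>y\<in>box_verts (Suc d) L. lattice_weight (Suc d) (g(d := s)) y * F y)
    = (\<Sum>g'\<in>?V. \<Sum>t\<in>?I. of_bool (s = t) * (lattice_weight d g g' * F (g'(d := t)))
       + of_bool (g = g') * (path_weight s t * F (g'(d := t))))"
    unfolding sum_box_verts_Suc using assms
    by (intro sum.cong refl) (simp add: lattice_weight_Suc distrib_right mult.assoc)
  also have "\<dots> = (\<Sum>g'\<in>?V. lattice_weight d g g' * F (g'(d := s)))
      + (\<Sum>g'\<in>?V. of_bool (g = g') * (\<Sum>t\<in>?I. path_weight s t * F (g'(d := t))))"
    using assms(2) by (simp only: sum.distrib sum_of_bool_eq finite_atLeastAtMost_int sum_distrib_left)
  finally show ?thesis
    using assms(1) by (simp only: sum_of_bool_eq finite_box_verts)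
qed

lemma rw_poincare_box: "rw_poincare (box_verts d L) (lattice_weight d) (cos_gap L)"
proof (induction d)
  case 0
  then show ?case
    by (simp add: rw_poincare_def rw_energy_def box_verts_def lattice_weight_def nearest_neighbours_def)
next
  case (Suc d)
  let ?V = "box_verts d L" and ?I = "{0..int L}"
  show ?case unfolding rw_poincare_def
  proof (intro allI impI)
    fix h :: "(nat \<Rightarrow> int) \<Rightarrow> real" assume h0: "(\<Sum>x\<in>box_verts (Suc d) L. h x) = 0"
    define k where "k g s = h (g(d := s))" for g s
    have "rw_energy (box_verts (Suc d) L) (lattice_weight (Suc d)) h
      = (\<Sum>g\<in>?V. \<Sum>s\<in>?I. (\<Sum>g'\<in>?V. lattice_weight d g g' * (k g s - k g' s)\<^sup>2)
          + (\<Sum>t\<in>?I. path_weight s t * (k g s - k g t)\<^sup>2)) / 2"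
      unfolding rw_energy_def sum_box_verts_Suc[of "\<lambda>x. \<Sum>y\<in>box_verts (Suc d) L. _ x y"] k_def
      by (intro arg_cong2[where f = "(/)"] sum.cong refl) (simp only: sum_lattice_weight_Suc)
    also have "\<dots> = (\<Sum>s\<in>?I. rw_energy ?V (lattice_weight d) (\<lambda>g. k g s)) + (\<Sum>g\<in>?V. rw_energy ?I path_weight (k g))"
      unfolding rw_energy_def sum.distrib sum_divide_distrib[symmetric] add_divide_distrib
      by (simp only: sum.swap[of _ ?I ?V])
    also have "\<dots> \<ge> cos_gap L * (\<Sum>g\<in>?V. \<Sum>s\<in>?I. (k g s)\<^sup>2)"
      using h0 unfolding sum_box_verts_Suc
      by (intro rw_poincare_product Suc rw_poincare_path cos_gap_nonneg)
        (simp_all add: k_def lattice_weight_def)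
    finally show "cos_gap L * (\<Sum>x\<in>box_verts (Suc d) L. (h x)\<^sup>2) \<le> rw_energy (box_verts (Suc d) L) (lattice_weight (Suc d)) h"
      by (simp add: sum_box_verts_Suc k_def)
  qed
qed

text \<open>The shift by \<open>1 / 2\<close> makes the cosine symmetric about both \<open>- 1 / 2\<close> and \<open>L + 1 / 2\<close>, hence equal at a boundary site and
at its missing neighbour.\<close>
definition cos_mode :: "nat \<Rightarrow> int \<Rightarrow> real" where
  "cos_mode L s = cos (pi / (real L + 1) * (real_of_int s + 1 / 2))"

lemma cos_mode_eigen:
  assumes "s \<in> {0..int L}"
  shows "(\<Sum>t\<in>{0..int L}. path_weight s t * (cos_mode L t - cos_mode L s)) = - cos_gap L * cos_mode L s"
proof -
  let ?I = "{0..int L}" and ?u = "\<lambda>t. cos_mode L t - cos_mode L s"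
  define \<theta> where "\<theta> = pi / (real L + 1)"
  have outside: "?u (s - 1) = 0" if "s - 1 \<notin> ?I"
  proof -
    have "s = 0" using that assms by auto
    then show ?thesis by (simp add: cos_mode_def)
  qed
  have outside': "?u (s + 1) = 0" if "s + 1 \<notin> ?I"
  proof -
    have s: "s = int L" using that assms by auto
    have "\<theta> * (real_of_int (s + 1) + 1 / 2) = 2 * pi - \<theta> * (real_of_int s + 1 / 2)"
      by (simp add: \<theta>_def s field_simps)
    then have "cos_mode L (s + 1) = cos_mode L s"
      unfolding cos_mode_def \<theta>_def[symmetric] by (simp add: cos_diff)
    then show ?thesis by simp
  qed
  have "(\<Sum>t\<in>?I. path_weight s t * ?u t) = (\<Sum>t\<in>{s - 1, s + 1} \<inter> ?I. ?u t)"
    by (intro sum.mono_neutral_cong_right) (auto simp: path_weight_def)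
  also have "\<dots> = (\<Sum>t\<in>{s - 1, s + 1}. ?u t)"
  proof (intro sum.mono_neutral_left ballI)
    fix t assume "t \<in> {s - 1, s + 1} - {s - 1, s + 1} \<inter> ?I"
    then have "t = s - 1 \<and> s - 1 \<notin> ?I \<or> t = s + 1 \<and> s + 1 \<notin> ?I" by blast
    then show "?u t = 0" using outside outside' by blast
  qed auto
  also have "\<dots> = cos_mode L (s - 1) + cos_mode L (s + 1) - 2 * cos_mode L s" by simp
  also have "cos_mode L (s - 1) + cos_mode L (s + 1) = 2 * cos \<theta> * cos_mode L s"
  proof -
    have "\<theta> * (real_of_int (s - 1) + 1 / 2) = \<theta> * (real_of_int s + 1 / 2) - \<theta>"
      "\<theta> * (real_of_int (s + 1) + 1 / 2) = \<theta> * (real_of_int s + 1 / 2) + \<theta>"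
      by (simp_all add: algebra_simps)
    then show ?thesis
      unfolding cos_mode_def \<theta>_def[symmetric] by (simp add: cos_diff cos_add)
  qed
  finally show ?thesis by (simp add: cos_gap_def \<theta>_def algebra_simps)
qed

text \<open>The last coordinate is used because \<open>sum_lattice_weight_Suc\<close> splits it off; a function of this coordinate
does not change along the edges in the other directions.\<close>
lemma box_cos_mode_eigen:
  assumes "x \<in> box_verts (Suc d) L"
  shows "(\<Sum>y\<in>box_verts (Suc d) L. lattice_weight (Suc d) x y * (cos_mode L (y d) - cos_mode L (x d)))
    = - cos_gap L * cos_mode L (x d)"
proof -
  have "x \<in> (\<lambda>(s, g). g(d := s)) ` ({0..int L} \<times> box_verts d L)"
    using assms unfolding box_verts_def lessThan_Suc PiE_insert_eq .
  then obtain g s where x: "x = g(d := s)" "g \<in> box_verts d L" "s \<in> {0..int L}" by auto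
  show ?thesis
    unfolding x(1) sum_lattice_weight_Suc[OF x(2,3)] using cos_mode_eigen[OF x(3)] by simp
qed

lemma box_cos_mode_nonconstant:
  assumes "1 \<le> L"
  obtains x y where "x \<in> box_verts (Suc d) L" "y \<in> box_verts (Suc d) L" "cos_mode L (x d) \<noteq> cos_mode L (y d)"
proof -
  define e :: "int \<Rightarrow> nat \<Rightarrow> int" where "e s = (\<lambda>i\<in>{..<Suc d}. if i = d then s else 0)" for s
  have mem: "e s \<in> box_verts (Suc d) L" if "s \<in> {0..1}" for s
    using that assms by (auto simp: e_def box_verts_def)
  have "cos_mode L 1 < cos_mode L 0"
    unfolding cos_mode_def using assms
    by (intro cos_monotone_0_pi) (auto simp: field_simps intro!: add_pos_nonneg)
  moreover have "e s d = s" for s by (simp add: e_def)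
  ultimately show ?thesis using mem[of 0] mem[of 1] that[of "e 0" "e 1"] by auto
qed


section \<open>The generator of the exclusion process\<close>

text \<open>Every edge occurs as two ordered pairs, whence the factor \<open>1 / 2\<close>. Swapping two sites of the same kind
has no effect, so the suppressed moves need not be excluded.\<close>
definition exclusion_generator :: "'a set \<Rightarrow> ('a \<Rightarrow> 'a \<Rightarrow> real) \<Rightarrow> ('a set \<Rightarrow> real) \<Rightarrow> 'a set \<Rightarrow> real" where
  "exclusion_generator V w f A = - (\<Sum>x\<in>V. \<Sum>y\<in>V. w x y * swap_grad f x y A) / 2"

text \<open>An edge that admits a move has exactly one occupied endpoint, so it determines the ordered pair of its
occupied and its vacant endpoint.\<close>
lemma exclusion_rate_eq_sum:
  assumes "finite V" "A \<subseteq> V" "\<And>x y. N x y \<longleftrightarrow> N y x"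
  shows "exclusion_rate {{x, y} | x y. x \<in> V \<and> y \<in> V \<and> N x y} A B
    = (\<Sum>i\<in>A. \<Sum>j\<in>V - A. of_bool (N i j \<and> B = insert j (A - {i})))"
proof -
  let ?P = "{p \<in> A \<times> (V - A). N (fst p) (snd p) \<and> B = insert (snd p) (A - {fst p})}"
  have finA: "finite A" using assms(1,2) by (rule rev_finite_subset)
  have "{e \<in> {{x, y} | x y. x \<in> V \<and> y \<in> V \<and> N x y}. \<exists>i j. e = {i, j} \<and> i \<in> A \<and> j \<notin> A \<and> B = insert j (A - {i})}
      = (\<lambda>p. {fst p, snd p}) ` ?P" (is "?L = ?R")
  proof (intro set_eqI iffI)
    fix e assume "e \<in> ?L"
    then obtain x y i j where e: "e = {x, y}" "x \<in> V" "y \<in> V" "N x y"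
      "e = {i, j}" "i \<in> A" "j \<notin> A" "B = insert j (A - {i})" by blast
    then have "j \<in> V" "N i j" using assms(3) by (auto simp: doubleton_eq_iff)
    then show "e \<in> ?R" using e by (intro image_eqI[of _ _ "(i, j)"]) auto
  next
    fix e assume "e \<in> ?R"
    then show "e \<in> ?L" using assms(2) by fastforce
  qed
  moreover have "inj_on (\<lambda>p. {fst p, snd p}) ?P"
    by (rule inj_onI) (auto simp: doubleton_eq_iff prod_eq_iff)
  ultimately have "exclusion_rate {{x, y} | x y. x \<in> V \<and> y \<in> V \<and> N x y} A B = card ?P"
    unfolding exclusion_rate_def by (simp add: card_image)
  also have "\<dots> = (\<Sum>p\<in>A \<times> (V - A). of_bool (N (fst p) (snd p) \<and> B = insert (snd p) (A - {fst p})))"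
    using finA assms(1) by (simp add: of_bool_def sum.inter_filter[symmetric])
  finally show ?thesis by (simp add: sum.cartesian_product case_prod_unfold)
qed

lemma rate_matrix_exclusion_eq_generator:
  assumes "finite V" "\<And>x y. N x y \<longleftrightarrow> N y x" "A \<in> exclusion_states V m"
  defines "S \<equiv> exclusion_states V m" and "E \<equiv> {{x, y} | x y. x \<in> V \<and> y \<in> V \<and> N x y}"
  shows "(\<Sum>B\<in>S. rate_matrix S (exclusion_rate E) A B * f B)
    = exclusion_generator V (\<lambda>x y. of_bool (N x y)) f A"
proof -
  let ?q = "exclusion_rate E A"
  have A: "A \<in> S" "A \<subseteq> V" using assms(3) by (simp_all add: S_def exclusion_states_def)
  have finS: "finite S" using assms(1) by (simp add: S_def)
  have "(\<Sum>B\<in>S. rate_matrix S (exclusion_rate E) A B * f B)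
    = - (\<Sum>B\<in>S - {A}. ?q B) * f A + (\<Sum>B\<in>S - {A}. ?q B * f B)"
  proof -
    have "(\<Sum>B\<in>S - {A}. rate_matrix S (exclusion_rate E) A B * f B) = (\<Sum>B\<in>S - {A}. ?q B * f B)"
      by (intro sum.cong refl) (auto simp: rate_matrix_def)
    moreover have "rate_matrix S (exclusion_rate E) A A = - (\<Sum>B\<in>S - {A}. ?q B)"
      by (simp add: rate_matrix_def)
    ultimately show ?thesis by (simp only: sum.remove[OF finS A(1)])
  qed
  also have "\<dots> = (\<Sum>B\<in>S - {A}. ?q B * (f B - f A))"
    by (simp add: right_diff_distrib sum_subtractf sum_distrib_right)
  also have "\<dots> = (\<Sum>B\<in>S. ?q B * (f B - f A))"
    by (simp add: sum.remove[OF finS A(1)])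
  also have "\<dots> = (\<Sum>B\<in>S. \<Sum>i\<in>A. \<Sum>j\<in>V - A. of_bool (N i j \<and> B = insert j (A - {i})) * (f B - f A))"
    unfolding E_def exclusion_rate_eq_sum[where N = N, OF assms(1) A(2) assms(2)] by (simp only: sum_distrib_right)
  also have "\<dots> = (\<Sum>i\<in>A. \<Sum>j\<in>V - A. \<Sum>B\<in>S. of_bool (N i j \<and> B = insert j (A - {i})) * (f B - f A))"
    by (subst sum.swap, rule sum.cong[OF refl], rule sum.swap)
  also have "\<dots> = (\<Sum>i\<in>A. \<Sum>j\<in>V - A. - (of_bool (N i j) * swap_grad f i j A))"
  proof (intro sum.cong refl)
    fix i j assume ij: "i \<in> A" "j \<in> V - A"
    have sw: "swap_sites i j A = insert j (A - {i})" using ij by (simp add: swap_sites_alt)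
    have "swap_sites i j A \<in> S"
      using ij A assms(3) unfolding S_def by (intro swap_sites_exclusion_states) auto
    then have "(\<Sum>B\<in>S. of_bool (swap_sites i j A = B) * (of_bool (N i j) * (f B - f A)))
        = of_bool (N i j) * (f (swap_sites i j A) - f A)"
      using finS by (intro sum_of_bool_eq)
    moreover have "(\<Sum>B\<in>S. of_bool (N i j \<and> B = insert j (A - {i})) * (f B - f A))
        = (\<Sum>B\<in>S. of_bool (swap_sites i j A = B) * (of_bool (N i j) * (f B - f A)))"
      by (intro sum.cong refl) (auto simp: sw of_bool_def)
    ultimately show "(\<Sum>B\<in>S. of_bool (N i j \<and> B = insert j (A - {i})) * (f B - f A))
        = - (of_bool (N i j) * swap_grad f i j A)"
      by (simp add: swap_grad_def algebra_simps)
  qed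
  also have "\<dots> = exclusion_generator V (\<lambda>x y. of_bool (N x y)) f A"
  proof -
    let ?F = "\<lambda>x y. of_bool (N x y) * swap_grad f x y A"
    have split: "(\<Sum>x\<in>V. G x) = (\<Sum>x\<in>A. G x) + (\<Sum>x\<in>V - A. G x)" for G :: "'a \<Rightarrow> real"
      using sum.subset_diff[OF A(2) assms(1), of G] by simp
    have same: "?F x y = 0" if "x \<in> A \<longleftrightarrow> y \<in> A" for x y
      using that by (simp add: swap_grad_def swap_sites_alt)
    have sym: "?F x y = ?F y x" for x y
      using assms(2)[of x y] by (simp add: swap_grad_sym[of f x y])
    have "(\<Sum>x\<in>V. \<Sum>y\<in>V. ?F x y) = (\<Sum>x\<in>A. \<Sum>y\<in>V - A. ?F x y) + (\<Sum>x\<in>V - A. \<Sum>y\<in>A. ?F x y)"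
      unfolding split sum.distrib by (simp add: same)
    also have "(\<Sum>x\<in>V - A. \<Sum>y\<in>A. ?F x y) = (\<Sum>x\<in>A. \<Sum>y\<in>V - A. ?F x y)"
      by (subst sum.swap) (simp only: sym)
    finally show ?thesis
      by (simp add: exclusion_generator_def sum_negf)
  qed
  finally show ?thesis .
qed

lemma sum_mult_exclusion_generator:
  assumes "finite V"
  shows "(\<Sum>A\<in>exclusion_states V m. f A * exclusion_generator V w f A) = - exclusion_energy V w m f"
proof -
  let ?S = "exclusion_states V m"
  have "(\<Sum>A\<in>?S. f A * exclusion_generator V w f A)
    = - (\<Sum>A\<in>?S. \<Sum>x\<in>V. \<Sum>y\<in>V. w x y * (f A * swap_grad f x y A)) / 2"
    by (simp add: exclusion_generator_def sum_negf sum_divide_distrib sum_distrib_left mult_ac)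
  also have "(\<Sum>A\<in>?S. \<Sum>x\<in>V. \<Sum>y\<in>V. w x y * (f A * swap_grad f x y A))
    = (\<Sum>x\<in>V. \<Sum>y\<in>V. w x y * (\<Sum>A\<in>?S. f A * swap_grad f x y A))"
    unfolding sum_distrib_left by (subst sum.swap, rule sum.cong[OF refl], rule sum.swap)
  also have "\<dots> = (\<Sum>x\<in>V. \<Sum>y\<in>V. w x y * swap_energy ?S f x y)"
  proof (intro sum.cong refl)
    fix x y assume "x \<in> V" "y \<in> V"
    then show "w x y * (\<Sum>A\<in>?S. f A * swap_grad f x y A) = w x y * swap_energy ?S f x y"
      by (subst sum_mult_swap_grad) (simp_all add: swap_sites_exclusion_states swap_energy_def power2_eq_square)
  qed
  finally show ?thesis by (simp add: exclusion_energy_def)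
qed

text \<open>The uniform measure is stationary. An eigenfunction with nonzero eigenvalue therefore has total zero.\<close>
lemma sum_exclusion_generator:
  assumes "finite V"
  shows "(\<Sum>A\<in>exclusion_states V m. exclusion_generator V w f A) = 0"
proof -
  let ?S = "exclusion_states V m"
  have "(\<Sum>A\<in>?S. \<Sum>x\<in>V. \<Sum>y\<in>V. w x y * swap_grad f x y A)
    = (\<Sum>x\<in>V. \<Sum>y\<in>V. w x y * (\<Sum>A\<in>?S. swap_grad f x y A))"
    unfolding sum_distrib_left by (subst sum.swap, rule sum.cong[OF refl], rule sum.swap)
  also have "\<dots> = 0"
  proof (intro sum.neutral ballI)
    fix x y assume "x \<in> V" "y \<in> V"
    then have "(\<Sum>A\<in>?S. f (swap_sites x y A)) = (\<Sum>A\<in>?S. f A)"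
      by (intro sum_swap_sites swap_sites_exclusion_states)
    then show "w x y * (\<Sum>A\<in>?S. swap_grad f x y A) = 0"
      by (simp add: swap_grad_def sum_subtractf)
  qed
  finally show ?thesis
    by (simp add: exclusion_generator_def sum_negf sum_divide_distrib[symmetric])
qed

text \<open>The linear functions are invariant: exclusion suppresses only moves between occupied sites, and the
two directions of such a move would cancel in the sum.\<close>
lemma exclusion_generator_site_sum:
  assumes "finite V" "A \<subseteq> V" "\<And>x y. w x y = w y x"
  shows "exclusion_generator V w (site_sum h) A = site_sum (\<lambda>x. \<Sum>y\<in>V. w x y * (h y - h x)) A"
proof -
  have finA: "finite A" using assms(1,2) by (rule rev_finite_subset)
  let ?T = "\<Sum>x\<in>V. of_bool (x \<in> A) * (\<Sum>y\<in>V. w x y * (h x - h y))"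
  have "(\<Sum>x\<in>V. \<Sum>y\<in>V. w x y * swap_grad (site_sum h) x y A)
    = (\<Sum>x\<in>V. \<Sum>y\<in>V. of_bool (x \<in> A) * (w x y * (h x - h y))) + (\<Sum>x\<in>V. \<Sum>y\<in>V. of_bool (y \<in> A) * (w x y * (h y - h x)))"
    unfolding sum.distrib[symmetric]
    by (intro sum.cong refl) (simp add: swap_grad_site_sum[OF finA] algebra_simps)
  also have "(\<Sum>x\<in>V. \<Sum>y\<in>V. of_bool (y \<in> A) * (w x y * (h y - h x))) = (\<Sum>y\<in>V. \<Sum>x\<in>V. of_bool (y \<in> A) * (w y x * (h y - h x)))"
    by (subst sum.swap) (simp only: assms(3))
  finally have "(\<Sum>x\<in>V. \<Sum>y\<in>V. w x y * swap_grad (site_sum h) x y A) = 2 * ?T"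
    by (simp add: sum_distrib_left)
  moreover have "site_sum (\<lambda>x. \<Sum>y\<in>V. w x y * (h y - h x)) A = - ?T"
  proof -
    have "?T = (\<Sum>x\<in>A. \<Sum>y\<in>V. w x y * (h x - h y))"
      using assms(1,2) by (intro sum.mono_neutral_cong_right) auto
    then show ?thesis
      unfolding site_sum_def by (simp add: sum_negf[symmetric] algebra_simps)
  qed
  ultimately show ?thesis by (simp add: exclusion_generator_def)
qed

section \<open>The spectral gap in a box\<close>

text \<open>The gap is the same for all admissible numbers of particles, so the dependence of \<open>m\<close> on \<open>L\<close> does not
affect the limit.\<close>
theorem exclusion_gap_box:
  assumes "1 \<le> d" "1 \<le> L" "1 \<le> m" "m \<le> (L + 1) ^ d - 1"
  shows "exclusion_gap (box_verts d L) (box_edges d L) m = cos_gap L"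
proof -
  obtain d' where d: "d = Suc d'" using assms(1) by (cases d) auto
  let ?V = "box_verts d L"
  let ?w = "lattice_weight d"
  define S where "S = exclusion_states ?V m"
  define Q where "Q = rate_matrix S (exclusion_rate (box_edges d L))"
  have gen: "(\<Sum>B\<in>S. Q A B * f B) = exclusion_generator ?V ?w f A" if "A \<in> S" for A f
    using rate_matrix_exclusion_eq_generator[of ?V "nearest_neighbours d" A m f] that nearest_neighbours_sym
    unfolding S_def Q_def box_edges_def lattice_weight_def by auto
  have w_sym: "?w x y = ?w y x" for x y by (simp add: lattice_weight_def nearest_neighbours_sym)
  have w_nonneg: "0 \<le> ?w x y" for x y by (simp add: lattice_weight_def)
  have finS: "finite S" by (simp add: S_def)
  have m: "m < card ?V" using assms(3,4) by (simp add: card_box_verts)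
  have "(LEAST \<alpha>. \<alpha> > 0 \<and> (\<exists>f :: (nat \<Rightarrow> int) set \<Rightarrow> real. (\<exists>x\<in>S. f x \<noteq> 0) \<and>
           (\<forall>x\<in>S. (\<Sum>y\<in>S. Q x y * f y) = - \<alpha> * f x))) = cos_gap L"
  proof (rule Least_equality)
    let ?h = "\<lambda>x. cos_mode L (x d')"
    have eigen: "(\<Sum>B\<in>S. Q A B * site_sum ?h B) = - cos_gap L * site_sum ?h A" if A: "A \<in> S" for A
    proof -
      have AV: "A \<subseteq> ?V" using A by (simp add: S_def exclusion_states_def)
      have "(\<Sum>B\<in>S. Q A B * site_sum ?h B) = site_sum (\<lambda>x. \<Sum>y\<in>?V. ?w x y * (?h y - ?h x)) A"
        unfolding gen[OF A] using AV w_sym by (intro exclusion_generator_site_sum) auto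
      also have "\<dots> = site_sum (\<lambda>x. - cos_gap L * ?h x) A"
        unfolding site_sum_def using AV box_cos_mode_eigen[of _ d' L, folded d] by (intro sum.cong refl) blast
      finally show ?thesis by (simp add: site_sum_def sum_distrib_left)
    qed
    \<comment> \<open>the eigenfunction is nonzero: moving a particle from \<open>x\<close> to \<open>y\<close> changes its value\<close>
    obtain x y where xy: "x \<in> ?V" "y \<in> ?V" "?h x \<noteq> ?h y"
      using box_cos_mode_nonconstant[OF assms(2), of d'] unfolding d by metis
    have "card {A \<in> S. x \<in> A \<and> y \<notin> A} = (card ?V - 2) choose (m - 1)"
      unfolding S_def using xy assms(3) by (intro card_states_separating) auto
    moreover have "(card ?V - 2) choose (m - 1) > 0" using m assms(3) by simp
    ultimately have "{A \<in> S. x \<in> A \<and> y \<notin> A} \<noteq> {}" by (metis card.empty less_irrefl)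
    then obtain A where A: "A \<in> S" "x \<in> A" "y \<notin> A" by blast
    have sw: "swap_sites x y A \<in> S"
      using A(1) xy unfolding S_def by (intro swap_sites_exclusion_states)
    have "finite A" using A(1) finite_subset[OF _ finite_box_verts, of A d L] by (simp add: S_def exclusion_states_def)
    then have "swap_grad (site_sum ?h) x y A \<noteq> 0"
      using A xy by (simp add: swap_grad_site_sum)
    then have "site_sum ?h A \<noteq> 0 \<or> site_sum ?h (swap_sites x y A) \<noteq> 0"
      by (auto simp: swap_grad_def)
    then have "\<exists>A\<in>S. site_sum ?h A \<noteq> 0" using A(1) sw by blast
    then show "cos_gap L > 0 \<and> (\<exists>f. (\<exists>x\<in>S. f x \<noteq> 0) \<and> (\<forall>x\<in>S. (\<Sum>y\<in>S. Q x y * f y) = - cos_gap L * f x))"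
      using cos_gap_pos[OF assms(2)] eigen by (intro conjI exI[of _ "site_sum ?h"]) auto
  next
    fix \<alpha> assume "\<alpha> > 0 \<and> (\<exists>f. (\<exists>x\<in>S. f x \<noteq> 0) \<and> (\<forall>x\<in>S. (\<Sum>y\<in>S. Q x y * f y) = - \<alpha> * f x))"
    then obtain f where \<alpha>: "\<alpha> > 0" and nz: "\<exists>A\<in>S. f A \<noteq> 0"
      and eig: "\<And>A. A \<in> S \<Longrightarrow> exclusion_generator ?V ?w f A = - \<alpha> * f A"
      using gen by auto
    have "- \<alpha> * (\<Sum>A\<in>S. f A) = (\<Sum>A\<in>S. exclusion_generator ?V ?w f A)"
      by (simp add: eig sum_distrib_left)
    then have "(\<Sum>A\<in>S. f A) = 0"
      using \<alpha> by (simp add: S_def sum_exclusion_generator)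
    then have "cos_gap L * (\<Sum>A\<in>S. (f A)\<^sup>2) \<le> exclusion_energy ?V ?w m f"
      unfolding S_def using w_sym w_nonneg rw_poincare_box cos_gap_nonneg
      by (intro exclusion_poincare) auto
    also have "\<dots> = - (\<Sum>A\<in>S. f A * exclusion_generator ?V ?w f A)"
      by (simp add: S_def sum_mult_exclusion_generator)
    also have "\<dots> = \<alpha> * (\<Sum>A\<in>S. (f A)\<^sup>2)"
      by (simp add: eig sum_negf sum_distrib_left power2_eq_square mult_ac)
    finally have "cos_gap L * (\<Sum>A\<in>S. (f A)\<^sup>2) \<le> \<alpha> * (\<Sum>A\<in>S. (f A)\<^sup>2)" .
    moreover have "(\<Sum>A\<in>S. (f A)\<^sup>2) > 0"
    proof -
      obtain A where "A \<in> S" "f A \<noteq> 0" using nz by blast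
      then show ?thesis by (intro sum_pos2[OF finS, of A]) auto
    qed
    ultimately show "cos_gap L \<le> \<alpha>" by simp
  qed
  then show ?thesis
    by (simp add: exclusion_gap_def spectral_gap_def S_def Q_def)
qed

text \<open>With \<open>u = \<pi> / (2 (L + 1))\<close>, the half-angle formula gives \<open>cos_gap L = 4 (sin u)\<^sup>2\<close>.\<close>
lemma cos_gap_asymptotics: "(\<lambda>L. (real L)\<^sup>2 / pi\<^sup>2 * cos_gap L) \<longlonglongrightarrow> 1"
proof -
  define u where "u L = pi / (2 * (real L + 1))" for L
  have "u \<longlonglongrightarrow> 0"
    using tendsto_mult_right_zero[OF LIMSEQ_inverse_real_of_nat, of "pi / 2"]
    by (simp add: u_def[abs_def] field_simps)
  moreover have "u L \<noteq> 0" for L by (simp add: u_def)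
  ultimately have "filterlim u (at 0) sequentially"
    by (simp add: filterlim_at)
  then have sinc: "(\<lambda>L. sin (u L) / u L) \<longlonglongrightarrow> 1"
    using filterlim_compose[of "\<lambda>x :: real. sin x / x" "nhds 1" "at 0" u sequentially]
      DERIV_D[OF DERIV_sin[of "0 :: real"]] by simp
  have ratio: "(\<lambda>L. real L / (real L + 1)) \<longlonglongrightarrow> 1"
    using LIMSEQ_n_over_Suc_n by (simp add: add.commute)
  have "(real L)\<^sup>2 / pi\<^sup>2 * cos_gap L = (sin (u L) / u L)\<^sup>2 * (real L / (real L + 1))\<^sup>2" for L
  proof -
    have "pi / (real L + 1) = 2 * u L" by (simp add: u_def field_simps)
    then have "cos_gap L = 4 * (sin (u L))\<^sup>2"
      by (simp add: cos_gap_def cos_double_sin)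
    moreover have "a\<^sup>2 / pi\<^sup>2 * (4 * t\<^sup>2) = (t / (pi / (2 * b)))\<^sup>2 * (a / b)\<^sup>2"
      if "b \<noteq> 0" for a b t :: real
      using that by (simp add: power2_eq_square)
    note this[of "real L + 1" "real L" "sin (u L)", folded u_def]
    ultimately show ?thesis by simp
  qed
  then show ?thesis
    using tendsto_mult[OF tendsto_power[OF sinc, of 2] tendsto_power[OF ratio, of 2]] by simp
qed

theorem mainTheorem2:
  fixes d :: nat and m :: "nat \<Rightarrow> nat"
  assumes "d \<ge> 1"
    and "\<And>L. L \<ge> 1 \<Longrightarrow> 1 \<le> m L \<and> m L \<le> (L + 1) ^ d - 1"
  shows "(\<lambda>L. (real L)\<^sup>2 / pi\<^sup>2 * exclusion_gap (box_verts d L) (box_edges d L) (m L))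
           \<longlonglongrightarrow> 1"
proof -
  have "eventually (\<lambda>L. (real L)\<^sup>2 / pi\<^sup>2 * exclusion_gap (box_verts d L) (box_edges d L) (m L)
      = (real L)\<^sup>2 / pi\<^sup>2 * cos_gap L) sequentially"
    using eventually_ge_at_top[of 1] by eventually_elim (use assms in \<open>simp add: exclusion_gap_box\<close>)
  from tendsto_cong[OF this] show ?thesis using cos_gap_asymptotics by (rule iffD2)
qed

end
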